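(* There exists a one-dimensional CA $\mathcal{A}$ such that its persistent language $L_\mu(\mathcal{A})$, with $\mu$ the uniform Bernoulli measure on its alphabet, is not a recursive (decidable) set of words.
   Context: A one-dimensional cellular automaton (CA) $\mathcal{A}$ is given by a finite alphabet $Q$, a radius $r\ge 0$ and a local rule $\delta:Q^{2r+1}\to Q$; it acts on $c\in Q^{\mathbb{Z}}$ by $\mathcal{A}(c)_i=\delta(c_{i-r},\dots,c_{i+r})$. For $u\in Q^*$, $i\in\mathbb{Z}$, $[u]_i=\{c\in Q^{\mathbb{Z}}: c_i\cdots c_{i+|u|-1}=u\}$. The uniform Bernoulli measure $\mu$ satisfies $\mu([u]_i)=|Q|^{-|u|}$; $\mathcal{A}^n\mu(U)=\mu(\mathcal{A}^{-n}(U))$. A word $u$ is persistent for $(\mathcal{A},\mu)$ if $\mathcal{A}^n\mu([u]_0)$ does not tend to $0$ as $n\to\infty$; $L_\mu(\mathcal{A})$ is the set of persistent words. *)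

theory Defs
  imports "HOL-Probability.Probability" "HOL-Library.Nat_Bijection"
begin

datatype recf =
    Z
  | Sc
  | Id nat
  | Cn recf "recf list"
  | Pr recf recf
  | Mn recf

inductive eval :: "recf \<Rightarrow> nat list \<Rightarrow> nat \<Rightarrow> bool" where
  eval_Z: "eval Z xs 0"
| eval_Sc: "eval Sc (x # xs) (Suc x)"
| eval_Id: "i < length xs \<Longrightarrow> eval (Id i) xs (xs ! i)"
| eval_Cn: "length ys = length gs \<Longrightarrow> (\<forall>i<length gs. eval (gs ! i) xs (ys ! i))
            \<Longrightarrow> eval f ys z \<Longrightarrow> eval (Cn f gs) xs z"
| eval_Pr0: "eval f xs z \<Longrightarrow> eval (Pr f g) (0 # xs) z"
| eval_PrS: "eval (Pr f g) (n # xs) y \<Longrightarrow> eval g (y # n # xs) z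
            \<Longrightarrow> eval (Pr f g) (Suc n # xs) z"
| eval_Mn: "eval f (n # xs) 0 \<Longrightarrow> (\<forall>m<n. \<exists>y. eval f (m # xs) y \<and> y \<noteq> 0)
            \<Longrightarrow> eval (Mn f) xs n"

definition recursive_set :: "nat set \<Rightarrow> bool" where
  "recursive_set S \<longleftrightarrow> (\<exists>f. \<forall>n. eval f [n] (if n \<in> S then 1 else 0))"

definition recursive_lang :: "nat list set \<Rightarrow> bool" where
  "recursive_lang L \<longleftrightarrow> recursive_set (list_encode ` L)"

definition is_CA :: "nat \<Rightarrow> nat \<Rightarrow> (nat list \<Rightarrow> nat) \<Rightarrow> bool" where
  "is_CA q r \<delta> \<longleftrightarrow> q \<ge> 1 \<and>
     (\<forall>w. length w = 2 * r + 1 \<and> set w \<subseteq> {..<q} \<longrightarrow> \<delta> w < q)"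

definition CA_global :: "nat \<Rightarrow> (nat list \<Rightarrow> nat) \<Rightarrow> (int \<Rightarrow> nat) \<Rightarrow> (int \<Rightarrow> nat)" where
  "CA_global r \<delta> c = (\<lambda>i. \<delta> (map (\<lambda>j. c (i + int j - int r)) [0..<2 * r + 1]))"

definition cylinder :: "nat list \<Rightarrow> int \<Rightarrow> (int \<Rightarrow> nat) set" where
  "cylinder u i = {c. \<forall>j<length u. c (i + int j) = u ! j}"

definition bernoulli :: "nat \<Rightarrow> (int \<Rightarrow> nat) measure" where
  "bernoulli q = PiM (UNIV :: int set) (\<lambda>_. measure_pmf (pmf_of_set {..<q}))"

definition persistent :: "nat \<Rightarrow> nat \<Rightarrow> (nat list \<Rightarrow> nat) \<Rightarrow> nat list \<Rightarrow> bool" where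
  "persistent q r \<delta> u \<longleftrightarrow>
     \<not> ((\<lambda>n. measure (bernoulli q)
              ((CA_global r \<delta> ^^ n) -` cylinder u 0 \<inter> space (bernoulli q))) \<longlonglongrightarrow> 0)"

definition persistent_lang :: "nat \<Rightarrow> nat \<Rightarrow> (nat list \<Rightarrow> nat) \<Rightarrow> nat list set" where
  "persistent_lang q r \<delta> = {u \<in> lists {..<q}. persistent q r \<delta> u}"

end

(*
Information flows only to the right, and the cells labelled Wall cut it, so the future of a cell
depends on the finite random word between it and the nearest wall to its left. This word is read as
a certificate: some cells double the period of a clock, the next one starts registers at 0, a
register being the delay of a pulse train behind the clock, and each further cell performs one
transition of a fixed nondeterministic register program; failed tests, overflows and transitions
that do not fit together remove the clock for good. The word u_n consists of an end marker, n
decrements of register 0, and a zero test that has just emitted a pulse. Almost surely there is a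
wall on the left, so u_n dies out unless some run of the program ends with n in register 0; if there
is such a run, the finite word that spells it out occurs with positive probability and shows u_n
periodically forever.

The program guesses e and then a derivation of "function number e maps e to 0", by nondeterministic
rewriting of a stack of goals. Hence n |-> u_n reduces a nonrecursive set to the persistent language.
*)

theory Submission
  imports Defs "HOL-Number_Theory.Cong"
begin

section \<open>A nonrecursive set of function codes\<close>

text \<open>A random start configuration offers no input to compute from: a number can only be
  guessed by a certificate and then compared with a number of cells. Hence the nondeterministic
  programs, and hence a guessed e that is delivered at the end instead of being read at the start.
  Registers are unbounded while the alphabet is finite, so numbers live in time, as delays, and a
  delay makes sense only below the period of the clock. A certificate may contain any number of
  doubling cells, so every finite run fits under some period. Initial pulse sets are arbitrary, but
  they influence only the phase of a clock and the time at which it settles; whether it survives is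
  decided by the letters, and the invariants therefore speak of all sufficiently large times. The
  positive direction needs one common time for all configurations of a cylinder, and for this it
  fixes the pulse sets of the word as well. The words u_n have the shape x y^n z, which makes their
  codes recursive in n. The nonrecursive set is a diagonal one: a decider applied to its own code
  would return 0 exactly on a member.\<close>

lemma eval_deterministic: "eval f xs y \<Longrightarrow> eval f xs z \<Longrightarrow> y = z"
proof (induction arbitrary: z rule: eval.induct)
  case (eval_Cn ys gs xs f y)
  from eval_Cn.prems obtain ys' where ys': "length ys' = length gs"
    "\<forall>i<length gs. eval (gs ! i) xs (ys' ! i)" "eval f ys' z"
    by (cases rule: eval.cases) auto
  have "ys = ys'" using eval_Cn.hyps eval_Cn.IH(1) ys' by (intro nth_equalityI) auto
  then show ?case using eval_Cn.IH(2) ys' by simp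
next
  case (eval_Mn f n xs)
  from eval_Mn.prems have z: "eval f (z # xs) 0" "\<forall>m<z. \<exists>y. eval f (m # xs) y \<and> y \<noteq> 0"
    by (cases rule: eval.cases; simp)+
  show ?case
  proof (cases n z rule: linorder_cases)
    case less
    then obtain y where "eval f (n # xs) y" "y \<noteq> 0" using z(2) by auto
    then show ?thesis using eval_Mn.IH(1) by blast
  next
    case greater
    then show ?thesis using eval_Mn.IH(2) z(1) by blast
  qed simp
next
  case (eval_PrS f g n xs y z z')
  from eval_PrS.prems obtain y' where "eval (Pr f g) (n # xs) y'" "eval g (y' # n # xs) z'"
    by (cases rule: eval.cases) auto
  then show ?case using eval_PrS.IH by blast
next
  case (eval_Pr0 f xs y g)
  from eval_Pr0.prems have "eval f xs z" by (cases rule: eval.cases) auto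
  then show ?case by (rule eval_Pr0.IH)
next
  case eval_Z
  then show ?case by (cases rule: eval.cases) auto
next
  case eval_Sc
  then show ?case by (cases rule: eval.cases) auto
next
  case eval_Id
  from eval_Id.prems show ?case by (cases rule: eval.cases) auto
qed

section \<open>Recursive arithmetic on codes of words\<close>

lemma eval_Cn1: "eval g xs y \<Longrightarrow> eval f [y] z \<Longrightarrow> eval (Cn f [g]) xs z"
  by (rule eval_Cn[of "[y]"]) auto

lemma eval_Cn2: "eval g xs y \<Longrightarrow> eval h xs y' \<Longrightarrow> eval f [y, y'] z \<Longrightarrow> eval (Cn f [g, h]) xs z"
  by (rule eval_Cn[of "[y, y']"]) (auto simp: less_Suc_eq)

lemma eval_Id_nth: "i < length xs \<Longrightarrow> y = xs ! i \<Longrightarrow> eval (Id i) xs y"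
  by (simp add: eval_Id)

fun const_recf :: "nat \<Rightarrow> recf" where
  "const_recf 0 = Z"
| "const_recf (Suc n) = Cn Sc [const_recf n]"

lemma eval_const_recf: "eval (const_recf n) xs n"
  by (induction n) (auto intro: eval_Z eval_Cn1 eval_Sc)

definition add_recf :: recf where
  "add_recf = Pr (Id 0) (Cn Sc [Id 0])"

lemma eval_add_recf: "eval add_recf [m, n] (m + n)"
proof (induction m)
  case 0
  show ?case by (auto simp: add_recf_def intro!: eval_Pr0 eval_Id_nth)
next
  case (Suc m)
  have "eval (Cn Sc [Id 0]) [m + n, m, n] (Suc (m + n))"
    by (rule eval_Cn1[OF eval_Id_nth eval_Sc]) auto
  with Suc show ?case by (auto simp: add_recf_def intro: eval_PrS)
qed

definition triangle_recf :: recf where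
  "triangle_recf = Pr Z (Cn Sc [Cn add_recf [Id 0, Id 1]])"

lemma eval_triangle_recf: "eval triangle_recf [n] (triangle n)"
proof (induction n)
  case (Suc n)
  have "eval (Cn Sc [Cn add_recf [Id 0, Id 1]]) [triangle n, n] (Suc (triangle n + n))"
    by (auto intro!: eval_Cn1[OF eval_Cn2[OF eval_Id_nth eval_Id_nth eval_add_recf]] eval_Sc)
  with Suc show ?case by (auto simp: triangle_recf_def intro: eval_PrS)
qed (auto simp: triangle_recf_def intro: eval_Pr0 eval_Z)

text \<open>Under \<open>list_encode\<close> a nonempty list is the successor of a Cantor pair, and
  the pair of x and m is \<open>triangle (x + m) + x\<close>.\<close>

definition cons_recf :: "nat \<Rightarrow> recf" where
  "cons_recf x = Cn Sc [Cn add_recf [Cn triangle_recf [Cn add_recf [const_recf x, Id 0]], const_recf x]]"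

lemma eval_cons_recf: "eval (cons_recf x) (list_encode ys # xs) (list_encode (x # ys))"
  unfolding cons_recf_def
  by (auto simp: prod_encode_def intro!: eval_Sc eval_Cn1[OF eval_Cn2[OF
      eval_Cn1[OF eval_Cn2[OF eval_const_recf eval_Id_nth eval_add_recf] eval_triangle_recf]
      eval_const_recf eval_add_recf]])

definition pump_recf :: "nat \<Rightarrow> nat \<Rightarrow> nat \<Rightarrow> recf" where
  "pump_recf x y z = Cn (cons_recf x) [Pr (const_recf (list_encode [z])) (cons_recf y)]"

lemma eval_pump_recf: "eval (pump_recf x y z) [n] (list_encode (x # replicate n y @ [z]))"
proof -
  have "eval (Pr (const_recf (list_encode [z])) (cons_recf y)) [n] (list_encode (replicate n y @ [z]))"
  proof (induction n)
    case 0
    show ?case using eval_Pr0[OF eval_const_recf[of "list_encode [z]" "[]"]] by simp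
  next
    case (Suc n)
    show ?case
      using eval_PrS[OF Suc eval_cons_recf[of y "replicate n y @ [z]" "[n]"]] by simp
  qed
  then show ?thesis unfolding pump_recf_def
    by (rule eval_Cn1) (rule eval_cons_recf)
qed

text \<open>A many-one reduction: the code of the word is a recursive function of \<open>n\<close>,
  so a decider for \<open>L\<close> composes with it.\<close>

lemma recursive_lang_pumped:
  assumes "recursive_lang L"
  shows "recursive_set {n. x # replicate n y @ [z] \<in> L}"
proof -
  from assms obtain f where f: "\<And>n. eval f [n] (if n \<in> list_encode ` L then 1 else 0)"
    unfolding recursive_lang_def recursive_set_def by blast
  have "eval (Cn f [pump_recf x y z]) [n] (if x # replicate n y @ [z] \<in> L then 1 else 0)" for n
  proof -
    have "list_encode w \<in> list_encode ` L \<longleftrightarrow> w \<in> L" for w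
      using inj_list_encode by (metis UNIV_I inj_image_mem_iff)
    then show ?thesis
      using eval_Cn1[OF eval_pump_recf f[of "list_encode (x # replicate n y @ [z])"]] by presburger
  qed
  then show ?thesis unfolding recursive_set_def mem_Collect_eq by blast
qed

section \<open>Evaluation claims as a rewriting system on numbers\<close>

datatype tm = TVar nat | TZero | TSuc tm | TPair tm tm

fun val :: "tm \<Rightarrow> (nat \<Rightarrow> nat) \<Rightarrow> nat" where
  "val (TVar i) \<rho> = \<rho> i"
| "val TZero \<rho> = 0"
| "val (TSuc t) \<rho> = Suc (val t \<rho>)"
| "val (TPair t u) \<rho> = prod_encode (val t \<rho>, val u \<rho>)"

fun tvars :: "tm \<Rightarrow> nat set" where
  "tvars (TVar i) = {i}"
| "tvars TZero = {}"
| "tvars (TSuc t) = tvars t"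
| "tvars (TPair t u) = tvars t \<union> tvars u"

lemma val_cong: "(\<And>i. i \<in> tvars t \<Longrightarrow> \<rho> i = \<sigma> i) \<Longrightarrow> val t \<rho> = val t \<sigma>"
  by (induction t) auto

fun enc :: "recf \<Rightarrow> nat" where
  "enc Z = prod_encode (0, 0)"
| "enc Sc = prod_encode (1, 0)"
| "enc (Id i) = prod_encode (2, i)"
| "enc (Cn f gs) = prod_encode (3, prod_encode (enc f, list_encode (map enc gs)))"
| "enc (Pr f g) = prod_encode (4, prod_encode (enc f, enc g))"
| "enc (Mn f) = prod_encode (5, enc f)"

definition goal :: "nat \<Rightarrow> nat \<Rightarrow> nat \<Rightarrow> nat" where
  "goal c a r = prod_encode (c, prod_encode (a, r))"

text \<open>This is \<open>list_encode\<close> of a nonempty list, so one pattern serves argument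
  lists, lists of function codes and the stack of goals; 0 is the empty list.\<close>

definition push :: "nat \<Rightarrow> nat \<Rightarrow> nat" where
  "push x y = Suc (prod_encode (x, y))"

abbreviation "TGoal c a r \<equiv> TPair c (TPair a r)"
abbreviation "TPush x y \<equiv> TSuc (TPair x y)"
abbreviation "TTag k t \<equiv> TPair ((TSuc ^^ k) TZero) t"

text \<open>A goal (c, a, r) claims that the function coded by c maps the argument list coded by a to r.
  The tags 0 to 5 are those of the function codes; tag 6 claims that a list of functions has a
  list of values, and tag 7 that a function is nonzero at all first arguments below r, which is the
  second premise of minimisation. A rule replaces the topmost goal of a stack by goals that imply
  it, variables that occur only on the right being guessed.\<close>

definition rules :: "(tm \<times> tm) list" where
  "rules =
   [(TPush (TGoal (TTag 0 TZero) (TVar 1) TZero) (TVar 0),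
     TVar 0),
    (TPush (TGoal (TTag 1 TZero) (TPush (TVar 1) (TVar 2)) (TSuc (TVar 1))) (TVar 0),
     TVar 0),
    (TPush (TGoal (TTag 2 TZero) (TPush (TVar 1) (TVar 2)) (TVar 1)) (TVar 0),
     TVar 0),
    (TPush (TGoal (TTag 2 (TSuc (TVar 1))) (TPush (TVar 2) (TVar 3)) (TVar 4)) (TVar 0),
     TPush (TGoal (TTag 2 (TVar 1)) (TVar 3) (TVar 4)) (TVar 0)),
    (TPush (TGoal (TTag 3 (TPair (TVar 1) (TVar 2))) (TVar 3) (TVar 4)) (TVar 0),
     TPush (TGoal (TVar 1) (TVar 5) (TVar 4))
       (TPush (TGoal (TTag 6 (TVar 2)) (TVar 3) (TVar 5)) (TVar 0))),
    (TPush (TGoal (TTag 6 TZero) (TVar 1) TZero) (TVar 0),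
     TVar 0),
    (TPush (TGoal (TTag 6 (TPush (TVar 1) (TVar 2))) (TVar 3) (TPush (TVar 4) (TVar 5))) (TVar 0),
     TPush (TGoal (TVar 1) (TVar 3) (TVar 4))
       (TPush (TGoal (TTag 6 (TVar 2)) (TVar 3) (TVar 5)) (TVar 0))),
    (TPush (TGoal (TTag 4 (TPair (TVar 1) (TVar 2))) (TPush TZero (TVar 3)) (TVar 4)) (TVar 0),
     TPush (TGoal (TVar 1) (TVar 3) (TVar 4)) (TVar 0)),
    (TPush (TGoal (TTag 4 (TPair (TVar 1) (TVar 2))) (TPush (TSuc (TVar 3)) (TVar 4)) (TVar 5))
       (TVar 0),
     TPush (TGoal (TTag 4 (TPair (TVar 1) (TVar 2))) (TPush (TVar 3) (TVar 4)) (TVar 6))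
       (TPush (TGoal (TVar 2) (TPush (TVar 6) (TPush (TVar 3) (TVar 4))) (TVar 5)) (TVar 0))),
    (TPush (TGoal (TTag 5 (TVar 1)) (TVar 2) (TVar 3)) (TVar 0),
     TPush (TGoal (TVar 1) (TPush (TVar 3) (TVar 2)) TZero)
       (TPush (TGoal (TTag 7 (TVar 1)) (TVar 2) (TVar 3)) (TVar 0))),
    (TPush (TGoal (TTag 7 (TVar 1)) (TVar 2) TZero) (TVar 0),
     TVar 0),
    (TPush (TGoal (TTag 7 (TVar 1)) (TVar 2) (TSuc (TVar 3))) (TVar 0),
     TPush (TGoal (TVar 1) (TPush (TVar 3) (TVar 2)) (TSuc (TVar 4)))
       (TPush (TGoal (TTag 7 (TVar 1)) (TVar 2) (TVar 3)) (TVar 0)))]"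

text \<open>Rewriting takes place at the root only, because the rest of the stack is itself a
  variable of each rule. Rules are kept as terms so that one compiler can turn each of them into a
  register program.\<close>

definition reduces :: "(nat \<times> nat) set" where
  "reduces = {(val L \<rho>, val R \<rho>) | L R \<rho>. (L, R) \<in> set rules}"

lemma val_tag: "val ((TSuc ^^ k) TZero) \<rho> = k"
  by (induction k) auto

text \<open>The list \<open>vs\<close> gives the values of variables 0, 1, 2 and so on; in the
  instances below a guessed value comes last.\<close>

lemma reducesI:
  "k < length rules \<Longrightarrow> val (fst (rules ! k)) ((!) vs) = g \<Longrightarrow> val (snd (rules ! k)) ((!) vs) = h
   \<Longrightarrow> (g, h) \<in> reduces"
  unfolding reduces_def using nth_mem[of k rules] by (metis (mono_tags, lifting) CollectI prod.collapse)

lemma reduces_rules: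
  "(push (goal (prod_encode (0, 0)) a 0) w, w) \<in> reduces"
  "(push (goal (prod_encode (1, 0)) (push x a) (Suc x)) w, w) \<in> reduces"
  "(push (goal (prod_encode (2, 0)) (push x a) x) w, w) \<in> reduces"
  "(push (goal (prod_encode (2, Suc i)) (push x a) r) w, push (goal (prod_encode (2, i)) a r) w)
     \<in> reduces"
  "(push (goal (prod_encode (3, prod_encode (f, g))) a r) w,
    push (goal f b r) (push (goal (prod_encode (6, g)) a b) w)) \<in> reduces"
  "(push (goal (prod_encode (6, 0)) a 0) w, w) \<in> reduces"
  "(push (goal (prod_encode (6, push f g)) a (push x b)) w,
    push (goal f a x) (push (goal (prod_encode (6, g)) a b) w)) \<in> reduces"
  "(push (goal (prod_encode (4, prod_encode (f, g))) (push 0 a) r) w, push (goal f a r) w)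
     \<in> reduces"
  "(push (goal (prod_encode (4, prod_encode (f, g))) (push (Suc n) a) r) w,
    push (goal (prod_encode (4, prod_encode (f, g))) (push n a) x)
      (push (goal g (push x (push n a)) r) w)) \<in> reduces"
  "(push (goal (prod_encode (5, f)) a r) w,
    push (goal f (push r a) 0) (push (goal (prod_encode (7, f)) a r) w)) \<in> reduces"
  "(push (goal (prod_encode (7, f)) a 0) w, w) \<in> reduces"
  "(push (goal (prod_encode (7, f)) a (Suc n)) w,
    push (goal f (push n a) (Suc x)) (push (goal (prod_encode (7, f)) a n) w)) \<in> reduces"
  by (rule reducesI[of 0 "[w, a]"], simp_all add: rules_def goal_def push_def val_tag)
     (rule reducesI[of 1 "[w, x, a]"], simp_all add: rules_def goal_def push_def val_tag,
      rule reducesI[of 2 "[w, x, a]"], simp_all add: rules_def goal_def push_def val_tag,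
      rule reducesI[of 3 "[w, i, x, a, r]"], simp_all add: rules_def goal_def push_def val_tag,
      rule reducesI[of 4 "[w, f, g, a, r, b]"], simp_all add: rules_def goal_def push_def val_tag,
      rule reducesI[of 5 "[w, a]"], simp_all add: rules_def goal_def push_def val_tag,
      rule reducesI[of 6 "[w, f, g, a, x, b]"], simp_all add: rules_def goal_def push_def val_tag,
      rule reducesI[of 7 "[w, f, g, a, r]"], simp_all add: rules_def goal_def push_def val_tag,
      rule reducesI[of 8 "[w, f, g, n, a, r, x]"], simp_all add: rules_def goal_def push_def val_tag,
      rule reducesI[of 9 "[w, f, a, r]"], simp_all add: rules_def goal_def push_def val_tag,
      rule reducesI[of 10 "[w, f, a]"], simp_all add: rules_def goal_def push_def val_tag,
      rule reducesI[of 11 "[w, f, a, n, x]"], simp_all add: rules_def goal_def push_def val_tag)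

lemma list_encode_Cons_push: "list_encode (x # xs) = push x (list_encode xs)"
  by (simp add: push_def)

text \<open>Completeness of the rules. The rest \<open>w\<close> of the stack is arbitrary because a
  subgoal is discharged on top of its siblings, which stay untouched until it has been
  popped.\<close>

lemma goal_reduces:
  "eval f xs r \<Longrightarrow> (push (goal (enc f) (list_encode xs) r) w, w) \<in> reduces\<^sup>*"
proof (induction arbitrary: w rule: eval.induct)
  case (eval_Z xs)
  show ?case using reduces_rules(1) by auto
next
  case (eval_Sc x xs)
  show ?case using reduces_rules(2) by (auto simp: list_encode_Cons_push simp del: list_encode.simps)
next
  case (eval_Id i xs)
  then show ?case
  proof (induction i arbitrary: xs)
    case 0
    then show ?case using reduces_rules(3)
      by (cases xs) (auto simp: list_encode_Cons_push simp del: list_encode.simps)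
  next
    case (Suc i)
    then obtain x ys where xs: "xs = x # ys" "i < length ys" by (cases xs) auto
    then show ?case using Suc.IH[of ys]
        converse_rtrancl_into_rtrancl[OF reduces_rules(4)[of i x "list_encode ys" "ys ! i" w]]
      by (simp add: list_encode_Cons_push del: list_encode.simps(2))
  qed
next
  case (eval_Cn ys gs xs f z)
  \<comment> \<open>The values of all inner functions are guessed as one list; the tag 6 goal takes
    off its entries together with the functions.\<close>
  have "length ys = length gs \<Longrightarrow>
    \<forall>i<length gs. \<forall>w. (push (goal (enc (gs ! i)) (list_encode xs) (ys ! i)) w, w) \<in> reduces\<^sup>* \<Longrightarrow>
    (push (goal (prod_encode (6, list_encode (map enc gs))) (list_encode xs) (list_encode ys)) w, w)
      \<in> reduces\<^sup>*"
  proof (induction ys gs rule: list_induct2)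
    case Nil
    show ?case using reduces_rules(6) by auto
  next
    case (Cons y ys g gs)
    have "(push (goal (enc g) (list_encode xs) y) w', w') \<in> reduces\<^sup>*" for w'
      using Cons.prems[rule_format, of 0] by simp
    moreover have "(push (goal (prod_encode (6, list_encode (map enc gs))) (list_encode xs)
        (list_encode ys)) w, w) \<in> reduces\<^sup>*"
      using Cons.prems[rule_format, of "Suc _"] by (intro Cons.IH) simp
    ultimately show ?case
      by (metis (no_types, lifting) converse_rtrancl_into_rtrancl list.simps(9)
          list_encode_Cons_push reduces_rules(7) rtrancl_trans)
  qed
  then have "(push (goal (prod_encode (6, list_encode (map enc gs))) (list_encode xs)
      (list_encode ys)) w, w) \<in> reduces\<^sup>*"
    using eval_Cn by blast
  then show ?case using eval_Cn.IH(2) reduces_rules(5) unfolding enc.simps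
    by (meson converse_rtrancl_into_rtrancl rtrancl_trans)
next
  case (eval_Pr0 f xs z g)
  then show ?case unfolding enc.simps list_encode_Cons_push
    by (meson converse_rtrancl_into_rtrancl reduces_rules(8))
next
  case (eval_PrS f g n xs y z)
  then show ?case unfolding enc.simps list_encode_Cons_push
    by (meson converse_rtrancl_into_rtrancl rtrancl_trans reduces_rules(9))
next
  case (eval_Mn f n xs)
  \<comment> \<open>The tag 7 goal counts down from \<open>n\<close> and guesses, for each smaller
    argument, the nonzero value that minimisation demands.\<close>
  have "m \<le> n \<Longrightarrow> (push (goal (prod_encode (7, enc f)) (list_encode xs) m) w, w) \<in> reduces\<^sup>*" for m
  proof (induction m)
    case 0
    show ?case using reduces_rules(11) by auto
  next
    case (Suc m)
    then obtain y where "\<And>w. (push (goal (enc f) (list_encode (m # xs)) (Suc y)) w, w) \<in> reduces\<^sup>*"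
      using eval_Mn.IH(2) by (metis Suc_le_lessD not0_implies_Suc)
    then show ?case using Suc unfolding list_encode_Cons_push
      by (meson Suc_leD converse_rtrancl_into_rtrancl rtrancl_trans reduces_rules(12))
  qed
  from this[of n] show ?case using eval_Mn.IH(1) unfolding enc.simps list_encode_Cons_push
    by (meson converse_rtrancl_into_rtrancl order_refl rtrancl_trans reduces_rules(10))
qed

text \<open>Codes that denote no claim count as true, so that no rule has to check its codes.\<close>

definition goal_true :: "nat \<Rightarrow> bool" where
  "goal_true g \<longleftrightarrow>
     (\<forall>f xs r. g = goal (enc f) (list_encode xs) r \<longrightarrow> eval f xs r) \<and>
     (\<forall>gs xs ys. g = goal (prod_encode (6, list_encode (map enc gs))) (list_encode xs) (list_encode ys)
        \<longrightarrow> length ys = length gs \<and> (\<forall>i<length gs. eval (gs ! i) xs (ys ! i))) \<and>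
     (\<forall>f xs r. g = goal (prod_encode (7, enc f)) (list_encode xs) r
        \<longrightarrow> (\<forall>m<r. \<exists>y. eval f (m # xs) y \<and> y \<noteq> 0))"

definition stack_true :: "nat \<Rightarrow> bool" where
  "stack_true w \<longleftrightarrow> (\<forall>g \<in> set (list_decode w). goal_true g)"

section \<open>Soundness of the rewriting rules\<close>

lemma stack_true_push: "stack_true (push g w) \<longleftrightarrow> goal_true g \<and> stack_true w"
  by (simp add: stack_true_def push_def)

lemma enc_eq_tag:
  "enc f = prod_encode (0, a) \<longleftrightarrow> f = Z \<and> a = 0"
  "enc f = prod_encode (Suc 0, a) \<longleftrightarrow> f = Sc \<and> a = 0"
  "enc f = prod_encode (2, a) \<longleftrightarrow> f = Id a"
  "enc f = prod_encode (3, a) \<longleftrightarrow>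
     (\<exists>h gs. f = Cn h gs \<and> a = prod_encode (enc h, list_encode (map enc gs)))"
  "enc f = prod_encode (4, a) \<longleftrightarrow> (\<exists>h g. f = Pr h g \<and> a = prod_encode (enc h, enc g))"
  "enc f = prod_encode (5, a) \<longleftrightarrow> (\<exists>h. f = Mn h \<and> a = enc h)"
  "enc f \<noteq> prod_encode (6, a)"
  "enc f \<noteq> prod_encode (7, a)"
  by (cases f; auto)+

lemma list_encode_eq_push: "list_encode xs = push x a \<longleftrightarrow> (\<exists>ys. xs = x # ys \<and> a = list_encode ys)"
  by (cases xs) (auto simp: push_def)

lemma list_encode_eq_0: "list_encode xs = 0 \<longleftrightarrow> xs = []"
  by (cases xs) auto

lemma goal_true_code:
  "goal_true (goal (enc f) (list_encode xs) r) \<Longrightarrow> eval f xs r"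
  "goal_true (goal (prod_encode (6, list_encode (map enc gs))) (list_encode xs) (list_encode ys)) \<Longrightarrow>
     length ys = length gs \<and> (\<forall>i<length gs. eval (gs ! i) xs (ys ! i))"
  "goal_true (goal (prod_encode (7, enc f)) (list_encode xs) r) \<Longrightarrow>
     m < r \<Longrightarrow> \<exists>y. eval f (m # xs) y \<and> y \<noteq> 0"
  by (auto simp: goal_true_def)

lemma list_encode_map_enc_push:
  "push f g = list_encode (map enc gs) \<longleftrightarrow>
     (\<exists>h hs. gs = h # hs \<and> f = enc h \<and> g = list_encode (map enc hs))"
  by (cases gs) (auto simp: push_def)

lemma goal_true_function:
  assumes "\<And>f xs. c = enc f \<Longrightarrow> a = list_encode xs \<Longrightarrow> eval f xs r" "\<And>b. c \<noteq> prod_encode (6, b)"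
    "\<And>b. c \<noteq> prod_encode (7, b)"
  shows "goal_true (goal c a r)"
  using assms by (auto simp: goal_true_def goal_def)

lemma goal_true_list:
  assumes "\<And>gs xs ys. g = list_encode (map enc gs) \<Longrightarrow> a = list_encode xs \<Longrightarrow> b = list_encode ys \<Longrightarrow>
     length ys = length gs \<and> (\<forall>i<length gs. eval (gs ! i) xs (ys ! i))"
  shows "goal_true (goal (prod_encode (6, g)) a b)"
  using assms by (auto simp: goal_true_def goal_def enc_eq_tag dest!: sym[of "prod_encode _" "enc _"])

lemma goal_true_loop:
  assumes "\<And>f xs m. g = enc f \<Longrightarrow> a = list_encode xs \<Longrightarrow> m < r \<Longrightarrow> \<exists>y. eval f (m # xs) y \<and> y \<noteq> 0"
  shows "goal_true (goal (prod_encode (7, g)) a r)"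
  using assms by (auto simp: goal_true_def goal_def enc_eq_tag dest!: sym[of "prod_encode _" "enc _"])

text \<open>One clause per rule, in the order of \<open>rules\<close>. Since codes are injective,
  decoding the left-hand side determines its parts, and the matching introduction rule of
  \<open>eval\<close> applies to them.\<close>

lemma goal_true_rules:
  "goal_true (goal (prod_encode (0, 0)) a 0)"
  "goal_true (goal (prod_encode (1, 0)) (push x a) (Suc x))"
  "goal_true (goal (prod_encode (2, 0)) (push x a) x)"
  "goal_true (goal (prod_encode (2, i)) a r) \<Longrightarrow> goal_true (goal (prod_encode (2, Suc i)) (push x a) r)"
  "goal_true (goal f b r) \<Longrightarrow> goal_true (goal (prod_encode (6, g)) a b) \<Longrightarrow>
     goal_true (goal (prod_encode (3, prod_encode (f, g))) a r)"
  "goal_true (goal (prod_encode (6, 0)) a 0)"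
  "goal_true (goal f a x) \<Longrightarrow> goal_true (goal (prod_encode (6, g)) a b) \<Longrightarrow>
     goal_true (goal (prod_encode (6, push f g)) a (push x b))"
  "goal_true (goal f a r) \<Longrightarrow>
     goal_true (goal (prod_encode (4, prod_encode (f, g))) (push 0 a) r)"
  "goal_true (goal (prod_encode (4, prod_encode (f, g))) (push n a) x) \<Longrightarrow>
     goal_true (goal g (push x (push n a)) r) \<Longrightarrow>
     goal_true (goal (prod_encode (4, prod_encode (f, g))) (push (Suc n) a) r)"
  "goal_true (goal f (push r a) 0) \<Longrightarrow> goal_true (goal (prod_encode (7, f)) a r) \<Longrightarrow>
     goal_true (goal (prod_encode (5, f)) a r)"
  "goal_true (goal (prod_encode (7, f)) a 0)"
  "goal_true (goal f (push n a) (Suc x)) \<Longrightarrow> goal_true (goal (prod_encode (7, f)) a n) \<Longrightarrow>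
     goal_true (goal (prod_encode (7, f)) a (Suc n))"
proof -
  note sym_simps = eq_commute[of "prod_encode _" "enc _"] eq_commute[of "push _ _" "list_encode _"]
    eq_commute[of 0 "list_encode _"] enc_eq_tag list_encode_eq_push list_encode_eq_0
  show "goal_true (goal (prod_encode (0, 0)) a 0)"
    by (rule goal_true_function) (auto simp: sym_simps intro: eval_Z)
  show "goal_true (goal (prod_encode (1, 0)) (push x a) (Suc x))"
    by (rule goal_true_function) (auto simp: sym_simps intro: eval_Sc)
  show "goal_true (goal (prod_encode (2, 0)) (push x a) x)"
    by (rule goal_true_function) (auto simp: sym_simps intro: eval_Id_nth)
  show "goal_true (goal (prod_encode (2, Suc i)) (push x a) r)"
    if "goal_true (goal (prod_encode (2, i)) a r)"
  proof (rule goal_true_function)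
    fix f xs assume f: "prod_encode (2, Suc i) = enc f" and xs: "push x a = list_encode xs"
    obtain ys where "xs = x # ys" "a = list_encode ys" using xs by (auto simp: sym_simps)
    then show "eval f xs r"
      using f that goal_true_code(1)[of "Id i" ys r]
      by (auto simp: sym_simps elim: eval.cases intro!: eval_Id_nth)
  qed auto
  show "goal_true (goal (prod_encode (3, prod_encode (f, g))) a r)"
    if "goal_true (goal f b r)" "goal_true (goal (prod_encode (6, g)) a b)"
  proof (rule goal_true_function)
    fix k xs assume k: "prod_encode (3, prod_encode (f, g)) = enc k" and xs: "a = list_encode xs"
    \<comment> \<open>The guessed \<open>b\<close> needs no check: every number codes a
      list.\<close>
    define ys where "ys = list_decode b"
    then have b: "b = list_encode ys" by simp
    obtain h gs where "k = Cn h gs" "f = enc h" "g = list_encode (map enc gs)"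
      using k by (auto simp: sym_simps)
    then show "eval k xs r"
      using that xs goal_true_code(1)[of h ys r] goal_true_code(2)[of gs xs ys] unfolding b
      by (auto intro: eval_Cn)
  qed auto
  show "goal_true (goal (prod_encode (6, 0)) a 0)"
    by (rule goal_true_list) (auto simp: sym_simps)
  show "goal_true (goal (prod_encode (6, push f g)) a (push x b))"
    if "goal_true (goal f a x)" "goal_true (goal (prod_encode (6, g)) a b)"
  proof (rule goal_true_list)
    fix gs xs ys
    assume "push f g = list_encode (map enc gs)" "a = list_encode xs" "push x b = list_encode ys"
    moreover then obtain h hs zs where "gs = h # hs" "f = enc h" "g = list_encode (map enc hs)"
      "ys = x # zs" "b = list_encode zs"
      by (auto simp: list_encode_map_enc_push sym_simps)
    ultimately show "length ys = length gs \<and> (\<forall>i<length gs. eval (gs ! i) xs (ys ! i))"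
      using that goal_true_code(1)[of h xs x] goal_true_code(2)[of hs xs zs]
      by (auto simp: less_Suc_eq_0_disj)
  qed
  show "goal_true (goal (prod_encode (4, prod_encode (f, g))) (push 0 a) r)"
    if "goal_true (goal f a r)"
    by (rule goal_true_function) (use that goal_true_code(1) in \<open>auto simp: sym_simps intro: eval_Pr0\<close>)
  show "goal_true (goal (prod_encode (4, prod_encode (f, g))) (push (Suc n) a) r)"
    if "goal_true (goal (prod_encode (4, prod_encode (f, g))) (push n a) x)"
      "goal_true (goal g (push x (push n a)) r)"
  proof (rule goal_true_function)
    fix k xs assume "prod_encode (4, prod_encode (f, g)) = enc k" "push (Suc n) a = list_encode xs"
    then obtain h h' ys where *: "k = Pr h h'" "f = enc h" "g = enc h'" "xs = Suc n # ys"
      "a = list_encode ys"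
      by (auto simp: sym_simps)
    then show "eval k xs r"
      using that goal_true_code(1)[of "Pr h h'" "n # ys" x] goal_true_code(1)[of h' "x # n # ys" r]
      by (auto simp: push_def intro: eval_PrS)
  qed auto
  show "goal_true (goal (prod_encode (5, f)) a r)"
    if "goal_true (goal f (push r a) 0)" "goal_true (goal (prod_encode (7, f)) a r)"
  proof (rule goal_true_function)
    fix k xs assume "prod_encode (5, f) = enc k" "a = list_encode xs"
    moreover then obtain h where "k = Mn h" "f = enc h" by (auto simp: sym_simps)
    ultimately show "eval k xs r"
      using that goal_true_code(1)[of h "r # xs" 0] goal_true_code(3)[of h xs r]
      by (auto simp: push_def intro: eval_Mn)
  qed auto
  show "goal_true (goal (prod_encode (7, f)) a 0)"
    by (rule goal_true_loop) auto
  show "goal_true (goal (prod_encode (7, f)) a (Suc n))"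
    if "goal_true (goal f (push n a) (Suc x))" "goal_true (goal (prod_encode (7, f)) a n)"
  proof (rule goal_true_loop)
    fix h xs m assume "f = enc h" "a = list_encode xs" "m < Suc n"
    then show "\<exists>y. eval h (m # xs) y \<and> y \<noteq> 0"
      using that goal_true_code(1)[of h "n # xs" "Suc x"] goal_true_code(3)[of h xs n m]
      by (auto simp: push_def less_Suc_eq)
  qed
qed

lemma reduces_stack_true:
  assumes "(g, h) \<in> reduces" "stack_true h"
  shows "stack_true g"
proof -
  from assms(1) obtain L R \<rho> where LR: "(L, R) \<in> set rules" and gh: "g = val L \<rho>" "h = val R \<rho>"
    unfolding reduces_def by blast
  have "list_all (\<lambda>(L, R). stack_true (val R \<rho>) \<longrightarrow> stack_true (val L \<rho>)) rules"
    unfolding rules_def list.pred_inject prod.case val.simps val_tag push_def[symmetric] stack_true_push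
    by (intro conjI impI TrueI; (elim conjE)?;
        (blast intro: goal_true_rules[unfolded goal_def] | simp))
  with LR gh assms(2) show ?thesis by (auto simp: list_all_iff)
qed

section \<open>The diagonal set\<close>

definition self_goal :: tm where
  "self_goal = TPush (TGoal (TVar 0) (TPush (TVar 0) TZero) TZero) TZero"

definition self_accepting :: "nat set" where
  "self_accepting = {e. (val self_goal (\<lambda>_. e), 0) \<in> reduces\<^sup>*}"

text \<open>One direction is completeness with an empty rest of the stack. For the other, truth is
  carried backwards along the derivation, starting from the empty stack 0, which is vacuously
  true.\<close>

lemma self_accepting_enc: "enc f \<in> self_accepting \<longleftrightarrow> eval f [enc f] 0"
proof
  have g: "val self_goal (\<lambda>_. enc f) = push (goal (enc f) (list_encode [enc f]) 0) 0"
    by (simp add: self_goal_def push_def goal_def)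
  show "enc f \<in> self_accepting" if "eval f [enc f] 0"
    unfolding self_accepting_def mem_Collect_eq g by (rule goal_reduces[OF that])
  assume "enc f \<in> self_accepting"
  then have "(push (goal (enc f) (list_encode [enc f]) 0) 0, 0) \<in> reduces\<^sup>*"
    unfolding self_accepting_def mem_Collect_eq g .
  then have "stack_true (push (goal (enc f) (list_encode [enc f]) 0) 0)"
    by (induction rule: converse_rtrancl_induct) (simp add: stack_true_def, rule reduces_stack_true)
  then show "eval f [enc f] 0"
    using goal_true_code(1) stack_true_push by blast
qed

text \<open>Diagonalisation: a characteristic function returns 0 on its own code iff that code is a
  member, where it ought to return 1.\<close>

lemma not_recursive_self_accepting: "\<not> recursive_set self_accepting"
proof
  assume "recursive_set self_accepting"
  then obtain f where f: "\<And>n. eval f [n] (if n \<in> self_accepting then 1 else 0)"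
    unfolding recursive_set_def by blast
  show False
    using f[of "enc f"] eval_deterministic[of f "[enc f]"] self_accepting_enc[of f]
    by (metis zero_neq_one)
qed

section \<open>Register programs\<close>

text \<open>Each action can be performed on pulse trains by a single cell that sees two consecutive
  pulse sets of its left neighbour; there, copying is as cheap as counting.\<close>

datatype act = Skip | Zero nat | Inc nat | Dec nat | Copy nat nat | Clr nat

fun asem :: "act \<Rightarrow> (nat \<Rightarrow> nat) \<Rightarrow> (nat \<Rightarrow> nat) \<Rightarrow> bool" where
  "asem Skip s s' \<longleftrightarrow> s' = s"
| "asem (Zero j) s s' \<longleftrightarrow> s j = 0 \<and> s' = s"
| "asem (Inc j) s s' \<longleftrightarrow> s' = s(j := Suc (s j))"
| "asem (Dec j) s s' \<longleftrightarrow> s j \<noteq> 0 \<and> s' = s(j := s j - 1)"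
| "asem (Copy i j) s s' \<longleftrightarrow> s' = s(i := s j)"
| "asem (Clr i) s s' \<longleftrightarrow> s' = s(i := 0)"

text \<open>The regular programs of dynamic logic. The number of iterations of a \<open>Star\<close>
  is guessed, and tests placed after it discard the wrong guesses.\<close>

datatype prog = Act act | Seq prog prog (infixr ";;" 65) | Alt prog prog | Star prog

fun psem :: "prog \<Rightarrow> ((nat \<Rightarrow> nat) \<times> (nat \<Rightarrow> nat)) set" where
  "psem (Act a) = {(s, s'). asem a s s'}"
| "psem (p ;; q) = psem p O psem q"
| "psem (Alt p q) = psem p \<union> psem q"
| "psem (Star p) = (psem p)\<^sup>*"

lemma psem_Act_iff [simp]: "(s, s') \<in> psem (Act a) \<longleftrightarrow> asem a s s'"
  by simp

lemma psem_Seq_iff [simp]: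
  "(s, s') \<in> psem (p ;; q) \<longleftrightarrow> (\<exists>s''. (s, s'') \<in> psem p \<and> (s'', s') \<in> psem q)"
  by auto

lemma psem_Alt_iff [simp]: "(s, s') \<in> psem (Alt p q) \<longleftrightarrow> (s, s') \<in> psem p \<or> (s, s') \<in> psem q"
  by simp

declare psem.simps(1-3) [simp del]

section \<open>Guessing, comparing and pairing numbers\<close>

definition guess :: "nat \<Rightarrow> prog" where
  "guess v = Act (Clr v) ;; Star (Act (Inc v))"

lemma psem_guess: "(s, s') \<in> psem (guess v) \<longleftrightarrow> (\<exists>n. s' = s(v := n))"
proof
  assume "(s, s') \<in> psem (guess v)"
  then have "(s(v := 0), s') \<in> (psem (Act (Inc v)))\<^sup>*"
    by (auto simp: guess_def)
  then show "\<exists>n. s' = s(v := n)"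
  proof (induction rule: rtrancl_induct)
    case (step t t')
    then obtain n where "t = s(v := n)" by blast
    with step.hyps(2) have "t' = s(v := Suc n)" by (simp add: fun_eq_iff)
    then show ?case ..
  qed blast
next
  assume "\<exists>n. s' = s(v := n)"
  then obtain n where "s' = s(v := n)" ..
  moreover have "(s(v := 0), s(v := n)) \<in> (psem (Act (Inc v)))\<^sup>*"
  proof (induction n)
    case (Suc n)
    have "(s(v := n), s(v := Suc n)) \<in> psem (Act (Inc v))"
      unfolding psem_Act_iff asem.simps by simp
    with Suc show ?case by (rule rtrancl_into_rtrancl)
  qed (rule rtrancl_refl)
  ultimately show "(s, s') \<in> psem (guess v)"
    by (auto simp: guess_def)
qed

definition seqs :: "prog list \<Rightarrow> prog" where
  "seqs ps = foldr (;;) ps (Act Skip)"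

lemma psem_guesses:
  "(s, s') \<in> psem (seqs (map guess vs)) \<longleftrightarrow> (\<forall>i. i \<notin> set vs \<longrightarrow> s' i = s i)"
proof (induction vs arbitrary: s)
  case Nil
  show ?case by (auto simp: seqs_def)
next
  case (Cons v vs)
  have "(s, s') \<in> psem (seqs (map guess (v # vs))) \<longleftrightarrow>
      (\<exists>n. (s(v := n), s') \<in> psem (seqs (map guess vs)))"
    by (auto simp: seqs_def psem_guess)
  also have "\<dots> \<longleftrightarrow> (\<exists>n. \<forall>i. i \<notin> set vs \<longrightarrow> s' i = (s(v := n)) i)"
    by (simp only: Cons.IH)
  also have "\<dots> \<longleftrightarrow> (\<forall>i. i \<notin> set (v # vs) \<longrightarrow> s' i = s i)"
    by (auto intro: exI[of _ "s' v"])
  finally show ?case .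
qed

text \<open>The final \<open>Skip\<close> adds an idle branch, harmless under the
  \<open>Star\<close> of \<open>acceptor\<close>.\<close>

definition alts :: "prog list \<Rightarrow> prog" where
  "alts ps = foldr Alt ps (Act Skip)"

lemma psem_alts: "(s, s') \<in> psem (alts ps) \<longleftrightarrow> s' = s \<or> (\<exists>p \<in> set ps. (s, s') \<in> psem p)"
  by (induction ps) (auto simp: alts_def)

text \<open>Registers 2 and 3 are scratch space of the next two programs. Pairing walks backwards along
  the diagonals of the Cantor enumeration, counting steps until the origin is reached.\<close>

definition equal :: "nat \<Rightarrow> nat \<Rightarrow> prog" where
  "equal x y = Act (Copy 2 x) ;; Act (Copy 3 y) ;; Star (Act (Dec 2) ;; Act (Dec 3)) ;;
     Act (Zero 2) ;; Act (Zero 3)"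

definition pair_step :: "nat \<Rightarrow> prog" where
  "pair_step d = Alt (Act (Dec 2) ;; Act (Inc 3) ;; Act (Inc d))
     (Act (Zero 2) ;; Act (Dec 3) ;; Act (Copy 2 3) ;; Act (Clr 3) ;; Act (Inc d))"

definition pair :: "nat \<Rightarrow> nat \<Rightarrow> nat \<Rightarrow> prog" where
  "pair d x y = Act (Copy 2 x) ;; Act (Copy 3 y) ;; Act (Clr d) ;; Star (pair_step d) ;;
     Act (Zero 2) ;; Act (Zero 3)"

text \<open>The loop preserves the difference of the two scratch registers, so both can end at 0
  only if they started equal. Register 2 is overwritten before \<open>y\<close> is read, whence the
  assumption.\<close>

lemma psem_equal:
  assumes "y \<noteq> 2"
  shows "(s, s') \<in> psem (equal x y) \<longleftrightarrow> s x = s y \<and> s' = s(2 := 0, 3 := 0)"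
proof -
  let ?B = "psem (Act (Dec 2) ;; Act (Dec 3))"
  have sound: "(u, u') \<in> ?B\<^sup>* \<Longrightarrow>
      u 2 + u' 3 = u' 2 + u 3 \<and> (\<forall>i. i \<notin> {2, 3} \<longrightarrow> u' i = u i)" for u u'
    by (induction rule: rtrancl_induct) (auto split: if_splits)
  have complete: "u 2 = n \<Longrightarrow> u 3 = n \<Longrightarrow> (u, u(2 := 0, 3 := 0)) \<in> ?B\<^sup>*" for u n
  proof (induction n arbitrary: u)
    case 0
    then have "u(2 := 0, 3 := 0) = u" by auto
    then show ?case by (metis rtrancl.rtrancl_refl)
  next
    case (Suc n)
    have "(u, u(2 := n, 3 := n)) \<in> ?B"
      using Suc.prems by (auto simp: fun_eq_iff intro!: exI[of _ "u(2 := n)"])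
    moreover have "(u(2 := n, 3 := n), u(2 := n, 3 := n, 2 := 0, 3 := 0)) \<in> ?B\<^sup>*"
      by (rule Suc.IH) simp_all
    moreover have "u(2 := n, 3 := n, 2 := 0, 3 := 0) = u(2 := 0, 3 := 0)"
      by (simp add: fun_eq_iff)
    ultimately show ?case by (metis converse_rtrancl_into_rtrancl)
  qed
  have iff: "(s, s') \<in> psem (equal x y) \<longleftrightarrow>
      (s(2 := s x, 3 := s y), s') \<in> ?B\<^sup>* \<and> s' 2 = 0 \<and> s' 3 = 0"
    using assms by (auto simp: equal_def)
  show ?thesis
  proof
    assume "(s, s') \<in> psem (equal x y)"
    with iff sound[of "s(2 := s x, 3 := s y)" s'] show "s x = s y \<and> s' = s(2 := 0, 3 := 0)"
      by (auto simp: fun_eq_iff)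
  next
    assume "s x = s y \<and> s' = s(2 := 0, 3 := 0)"
    with iff complete[of "s(2 := s x, 3 := s y)" "s x"] show "(s, s') \<in> psem (equal x y)"
      by simp
  qed
qed

lemma prod_encode_Suc_left: "prod_encode (Suc a, b) = Suc (prod_encode (a, Suc b))"
  by (simp add: prod_encode_def)

lemma prod_encode_0_Suc: "prod_encode (0, Suc b) = Suc (prod_encode (b, 0))"
  by (simp add: prod_encode_def)

text \<open>The loop invariant is the sum of register d and the Cantor code of registers 2 and 3:
  each step moves to the predecessor in the enumeration and increments d. At the origin the whole
  code has moved into d.\<close>

lemma psem_pair:
  assumes "y \<noteq> 2" "d \<noteq> 2" "d \<noteq> 3"
  shows "(s, s') \<in> psem (pair d x y) \<longleftrightarrow> s' = s(d := prod_encode (s x, s y), 2 := 0, 3 := 0)"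
proof -
  let ?B = "psem (pair_step d)"
  have pair_step: "(u, u') \<in> ?B \<longleftrightarrow>
      (u 2 \<noteq> 0 \<and> u' = u(2 := u 2 - 1, 3 := Suc (u 3), d := Suc (u d))) \<or>
      (u 2 = 0 \<and> u 3 \<noteq> 0 \<and> u' = u(2 := u 3 - 1, 3 := 0, d := Suc (u d)))" for u u'
  proof -
    have "u(3 := a, 2 := b, 3 := c) = u(2 := b, 3 := c)" for a b c
      by (simp add: fun_eq_iff)
    then show ?thesis
      using assms by (simp add: pair_step_def)
  qed
  have sound: "(u, u') \<in> ?B\<^sup>* \<Longrightarrow> u' d + prod_encode (u' 2, u' 3) = u d + prod_encode (u 2, u 3) \<and>
      (\<forall>i. i \<notin> {2, 3, d} \<longrightarrow> u' i = u i)" for u u'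
  proof (induction rule: rtrancl_induct)
    case (step v v')
    from \<open>(v, v') \<in> ?B\<close> have v': "(v 2 \<noteq> 0 \<and> v' = v(2 := v 2 - 1, 3 := Suc (v 3), d := Suc (v d))) \<or>
      (v 2 = 0 \<and> v 3 \<noteq> 0 \<and> v' = v(2 := v 3 - 1, 3 := 0, d := Suc (v d)))"
      by (rule pair_step[THEN iffD1])
    then have "v' d + prod_encode (v' 2, v' 3) = v d + prod_encode (v 2, v 3)"
      using assms prod_encode_Suc_left[of "v 2 - 1" "v 3"] prod_encode_0_Suc[of "v 3 - 1"] by auto
    moreover from v' have "\<forall>i. i \<notin> {2, 3, d} \<longrightarrow> v' i = v i" by auto
    ultimately show ?case using step.IH by auto
  qed auto
  have complete: "prod_encode (u 2, u 3) = n \<Longrightarrow> (u, u(d := u d + n, 2 := 0, 3 := 0)) \<in> ?B\<^sup>*" for u n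
  proof (induction n arbitrary: u)
    case 0
    then have "u 2 = 0" "u 3 = 0" 
      using le_prod_encode_1[of "u 2" "u 3"] le_prod_encode_2[of "u 3" "u 2"] by auto
    then have "u(d := u d + 0, 2 := 0, 3 := 0) = u" by auto
    then show ?case by (metis rtrancl.rtrancl_refl)
  next
    case (Suc n)
    then have "u 2 \<noteq> 0 \<or> u 3 \<noteq> 0" by (auto simp: prod_encode_def intro: gr0I)
    then consider "u 2 \<noteq> 0" | "u 2 = 0" "u 3 \<noteq> 0" by blast
    then obtain u' where u': "(u, u') \<in> ?B" "prod_encode (u' 2, u' 3) = n"
      "u'(d := u' d + n, 2 := 0, 3 := 0) = u(d := u d + Suc n, 2 := 0, 3 := 0)"
    proof cases
      case 1
      then show ?thesis
        using Suc.prems assms prod_encode_Suc_left[of "u 2 - 1" "u 3"]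
        by (intro that[of "u(2 := u 2 - 1, 3 := Suc (u 3), d := Suc (u d))"])
          (auto simp: pair_step fun_eq_iff)
    next
      case 2
      then show ?thesis
        using Suc.prems assms prod_encode_0_Suc[of "u 3 - 1"]
        by (intro that[of "u(2 := u 3 - 1, 3 := 0, d := Suc (u d))"])
          (auto simp: pair_step fun_eq_iff)
    qed
    then show ?case
      using Suc.IH[of u'] by (metis converse_rtrancl_into_rtrancl)
  qed
  have iff: "(s, s') \<in> psem (pair d x y) \<longleftrightarrow>
      (s(2 := s x, 3 := s y, d := 0), s') \<in> ?B\<^sup>* \<and> s' 2 = 0 \<and> s' 3 = 0"
    using assms by (auto simp: pair_def)
  show ?thesis
  proof
    assume "(s, s') \<in> psem (pair d x y)"
    with iff have *: "(s(2 := s x, 3 := s y, d := 0), s') \<in> ?B\<^sup>*" "s' 2 = 0" "s' 3 = 0" by auto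
    from sound[OF *(1)] *(2,3) assms show "s' = s(d := prod_encode (s x, s y), 2 := 0, 3 := 0)"
      by (auto simp: fun_eq_iff prod_encode_def)
  next
    assume "s' = s(d := prod_encode (s x, s y), 2 := 0, 3 := 0)"
    with iff complete[of "s(2 := s x, 3 := s y, d := 0)" "prod_encode (s x, s y)"] assms
    show "(s, s') \<in> psem (pair d x y)"
      by (auto simp: fun_upd_twist)
  qed
qed

text \<open>Variable i lives in register 4 + i; the value of the term is left in register d, and registers
  above d hold intermediate values.\<close>

fun compute :: "tm \<Rightarrow> nat \<Rightarrow> prog" where
  "compute (TVar i) d = Act (Copy d (4 + i))"
| "compute TZero d = Act (Clr d)"
| "compute (TSuc t) d = compute t d ;; Act (Inc d)"
| "compute (TPair t u) d = compute t d ;; compute u (Suc d) ;; pair d d (Suc d)"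

lemma psem_compute:
  assumes "\<forall>i \<in> tvars t. 4 + i < d" "3 < d" "(s, s') \<in> psem (compute t d)"
  shows "s' d = val t (\<lambda>i. s (4 + i)) \<and> (\<forall>i<d. i \<noteq> 2 \<and> i \<noteq> 3 \<longrightarrow> s' i = s i)"
  using assms
proof (induction t arbitrary: d s s')
  case (TSuc t)
  then show ?case by fastforce
next
  case (TPair t u)
  from TPair.prems(3) obtain s1 s2 where s: "(s, s1) \<in> psem (compute t d)"
    "(s1, s2) \<in> psem (compute u (Suc d))" "(s2, s') \<in> psem (pair d d (Suc d))"
    by auto
  have 1: "s1 d = val t (\<lambda>i. s (4 + i))" "\<forall>i<d. i \<noteq> 2 \<and> i \<noteq> 3 \<longrightarrow> s1 i = s i"
    using TPair.IH(1)[OF _ _ s(1)] TPair.prems by auto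
  have 2: "s2 (Suc d) = val u (\<lambda>i. s1 (4 + i))" "\<forall>i<Suc d. i \<noteq> 2 \<and> i \<noteq> 3 \<longrightarrow> s2 i = s1 i"
    using TPair.IH(2)[OF _ _ s(2)] TPair.prems(1,2) by (simp_all add: less_SucI)
  have "val u (\<lambda>i. s1 (4 + i)) = val u (\<lambda>i. s (4 + i))"
    using TPair.prems 1(2) by (intro val_cong) auto
  then show ?case
    using 1 2 s(3) TPair.prems(2) by (auto simp: psem_pair)
qed auto

text \<open>\<open>psem_compute\<close> describes the completed runs; being relational, it leaves
  open whether there is one.\<close>

lemma psem_compute_total: "3 < d \<Longrightarrow> \<exists>s'. (s, s') \<in> psem (compute t d)"
proof (induction t arbitrary: d s)
  case (TPair t u)
  then obtain s1 where s1: "(s, s1) \<in> psem (compute t d)" by blast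
  obtain s2 where "(s1, s2) \<in> psem (compute u (Suc d))"
    using TPair.IH(2)[of "Suc d"] TPair.prems by auto
  with s1 show ?case
    using psem_pair[of "Suc d" d s2 _ d] TPair.prems by fastforce
qed fastforce+

section \<open>Rewriting by register programs\<close>

text \<open>Matching by guessing: registers 4 to 11 receive values for variables 0 to 7, the
  left-hand side is rebuilt from them and compared with the stack in register 1. Thus no code ever
  has to be taken apart.\<close>

definition rewrite_prog :: "tm \<times> tm \<Rightarrow> prog" where
  "rewrite_prog = (\<lambda>(L, R). seqs (map guess [4..<12]) ;; compute L 12 ;; equal 12 1 ;;
     compute R 12 ;; Act (Copy 1 12))"

lemma psem_rewrite_prog_sound:
  assumes "tvars L \<union> tvars R \<subseteq> {..<8}" "(s, s') \<in> psem (rewrite_prog (L, R))"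
  shows "s' 0 = s 0 \<and> (\<exists>\<rho>. s 1 = val L \<rho> \<and> s' 1 = val R \<rho>)"
proof -
  obtain s1 s2 s3 s4 where s: "(s, s1) \<in> psem (seqs (map guess [4..<12]))"
    "(s1, s2) \<in> psem (compute L 12)" "(s2, s3) \<in> psem (equal 12 1)" "(s3, s4) \<in> psem (compute R 12)"
    and s': "s' = s4(1 := s4 12)"
    using assms(2) unfolding rewrite_prog_def prod.case psem_Seq_iff by auto
  have 1: "s1 0 = s 0" "s1 1 = s 1"
    using s(1) unfolding psem_guesses by auto
  have 2: "s2 12 = val L (\<lambda>i. s1 (4 + i))" "\<forall>i<12. i \<noteq> 2 \<and> i \<noteq> 3 \<longrightarrow> s2 i = s1 i"
    using psem_compute[OF _ _ s(2)] assms(1) by auto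
  have 3: "s2 12 = s2 1" "s3 = s2(2 := 0, 3 := 0)"
    using s(3) by (auto simp: psem_equal)
  have 4: "s4 12 = val R (\<lambda>i. s3 (4 + i))" "\<forall>i<12. i \<noteq> 2 \<and> i \<noteq> 3 \<longrightarrow> s4 i = s3 i"
    using psem_compute[OF _ _ s(4)] assms(1) by auto
  have "val R (\<lambda>i. s3 (4 + i)) = val R (\<lambda>i. s1 (4 + i))"
    using assms(1) 2(2) 3(2) by (intro val_cong) auto
  then show ?thesis
    using 1 2 3 4 s' by auto
qed

lemma psem_rewrite_prog_complete:
  assumes "tvars L \<union> tvars R \<subseteq> {..<8}" "s 1 = val L \<rho>"
  shows "\<exists>s'. (s, s') \<in> psem (rewrite_prog (L, R)) \<and> s' 0 = s 0 \<and> s' 1 = val R \<rho>"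
proof -
  define s1 where "s1 = (\<lambda>i. if i \<in> {4..<12} then \<rho> (i - 4) else s i)"
  have s1: "(s, s1) \<in> psem (seqs (map guess [4..<12]))"
    unfolding psem_guesses by (simp add: s1_def)
  have \<rho>: "val t (\<lambda>i. s1 (4 + i)) = val t \<rho>" if "tvars t \<subseteq> {..<8}" for t
    using that by (intro val_cong) (auto simp: s1_def)
  obtain s2 where s2: "(s1, s2) \<in> psem (compute L 12)"
    using psem_compute_total by fastforce
  have 2: "s2 12 = val L (\<lambda>i. s1 (4 + i))" "\<forall>i<12. i \<noteq> 2 \<and> i \<noteq> 3 \<longrightarrow> s2 i = s1 i"
    using psem_compute[OF _ _ s2] assms(1) by auto
  define s3 where "s3 = s2(2 := 0, 3 := 0)"
  have s3: "(s2, s3) \<in> psem (equal 12 1)"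
    using 2 assms \<rho>[of L] by (simp add: psem_equal s3_def s1_def)
  obtain s4 where s4: "(s3, s4) \<in> psem (compute R 12)"
    using psem_compute_total by fastforce
  have 4: "s4 12 = val R (\<lambda>i. s3 (4 + i))" "\<forall>i<12. i \<noteq> 2 \<and> i \<noteq> 3 \<longrightarrow> s4 i = s3 i"
    using psem_compute[OF _ _ s4] assms(1) by auto
  have "val R (\<lambda>i. s3 (4 + i)) = val R (\<lambda>i. s1 (4 + i))"
    using assms(1) 2(2) by (intro val_cong) (auto simp: s3_def)
  with 4 \<rho>[of R] assms(1) 2 have "s4 12 = val R \<rho>" "s4 0 = s 0"
    by (auto simp: s3_def s1_def)
  moreover have "(s, s4(1 := s4 12)) \<in> psem (rewrite_prog (L, R))"
    unfolding rewrite_prog_def prod.case psem_Seq_iff using s1 s2 s3 s4 by auto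
  ultimately show ?thesis by (intro exI[of _ "s4(1 := s4 12)"]) auto
qed

text \<open>Register 0 keeps the guessed number to the end, register 1 holds the stack, and the copy
  in register 4 plays variable 0 of \<open>self_goal\<close>. The last test demands the empty
  stack.\<close>

definition acceptor :: prog where
  "acceptor = guess 0 ;; Act (Copy 4 0) ;; compute self_goal 12 ;; Act (Copy 1 12) ;;
     Star (alts (map rewrite_prog rules)) ;; Act (Zero 1)"

lemma tvars_tag: "tvars ((TSuc ^^ k) TZero) = {}"
  by (induction k) auto

lemma tvars_rules: "(L, R) \<in> set rules \<Longrightarrow> tvars L \<union> tvars R \<subseteq> {..<8}"
  by (auto simp: rules_def tvars_tag)

lemma psem_acceptor: "(\<exists>s. ((\<lambda>_. 0), s) \<in> psem acceptor \<and> s 0 = e) \<longleftrightarrow> e \<in> self_accepting"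
proof -
  let ?B = "psem (alts (map rewrite_prog rules))"
  have sound: "(s, s') \<in> ?B\<^sup>* \<Longrightarrow> s' 0 = s 0 \<and> (s 1, s' 1) \<in> reduces\<^sup>*" for s s'
  proof (induction rule: rtrancl_induct)
    case (step u v)
    then have "v = u \<or> (v 0 = u 0 \<and> (u 1, v 1) \<in> reduces)"
      using psem_rewrite_prog_sound[OF tvars_rules] unfolding psem_alts reduces_def by fastforce
    with step.IH show ?case by auto
  qed auto
  have complete: "(g, h) \<in> reduces\<^sup>* \<Longrightarrow> s 1 = g \<Longrightarrow> \<exists>s'. (s, s') \<in> ?B\<^sup>* \<and> s' 0 = s 0 \<and> s' 1 = h"
    for g h s
  proof (induction rule: rtrancl_induct)
    case (step h h')
    then obtain u where u: "(s, u) \<in> ?B\<^sup>*" "u 0 = s 0" "u 1 = h" by blast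
    from step.hyps(2) obtain L R \<rho> where LR: "(L, R) \<in> set rules" "h = val L \<rho>" "h' = val R \<rho>"
      unfolding reduces_def by blast
    obtain s' where "(u, s') \<in> psem (rewrite_prog (L, R))" "s' 0 = u 0" "s' 1 = h'"
      using psem_rewrite_prog_complete[OF tvars_rules[OF LR(1)], of u] u LR by auto
    moreover from this(1) LR(1) have "(u, s') \<in> ?B"
      unfolding psem_alts by auto
    ultimately show ?case using u by (metis rtrancl_into_rtrancl)
  qed auto
  have self: "tvars self_goal = {0}" by (auto simp: self_goal_def)
  have self_val: "val self_goal \<rho> = val self_goal (\<lambda>_. e)" if "\<rho> 0 = e" for \<rho>
    using that by (intro val_cong) (auto simp: self)
  show ?thesis
  proof
    assume "\<exists>s. ((\<lambda>_. 0), s) \<in> psem acceptor \<and> s 0 = e"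
    then obtain s s1 n where s: "((\<lambda>_. 0)(0 := n, 4 := n), s1) \<in> psem (compute self_goal 12)"
      "(s1(1 := s1 12), s) \<in> ?B\<^sup>*" "s 1 = 0" "s 0 = e"
      unfolding acceptor_def psem_Seq_iff psem_guess by auto
    have "s1 12 = val self_goal (\<lambda>_. n) \<and> s1 0 = n"
      using psem_compute[OF _ _ s(1)] self by (auto simp: self_goal_def)
    with sound[OF s(2)] s(3,4) show "e \<in> self_accepting"
      by (auto simp: self_accepting_def)
  next
    assume "e \<in> self_accepting"
    then have red: "(val self_goal (\<lambda>_. e), 0) \<in> reduces\<^sup>*" by (simp add: self_accepting_def)
    obtain s1 where s1: "((\<lambda>_. 0)(0 := e, 4 := e), s1) \<in> psem (compute self_goal 12)"
      using psem_compute_total by fastforce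
    have "s1 12 = val self_goal (\<lambda>_. e) \<and> s1 0 = e"
      using psem_compute[OF _ _ s1] self by (auto simp: self_goal_def)
    then obtain s where "(s1(1 := s1 12), s) \<in> ?B\<^sup>*" "s 0 = e" "s 1 = 0"
      using complete[OF red, of "s1(1 := s1 12)"] by auto
    then have "((\<lambda>_. 0), s) \<in> psem acceptor \<and> s 0 = e"
      unfolding acceptor_def psem_Seq_iff psem_guess using s1 by fastforce
    then show "\<exists>s. ((\<lambda>_. 0), s) \<in> psem acceptor \<and> s 0 = e" by blast
  qed
qed

text \<open>A control state is the list of the programs that remain to be run; a program reaches only
  finitely many of them.\<close>

inductive ctl :: "prog list \<Rightarrow> act \<Rightarrow> prog list \<Rightarrow> bool" where
  "ctl (Act a # k) a k"
| "ctl ((p ;; q) # k) Skip (p # q # k)"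
| "ctl (Alt p q # k) Skip (p # k)"
| "ctl (Alt p q # k) Skip (q # k)"
| "ctl (Star p # k) Skip k"
| "ctl (Star p # k) Skip (p # Star p # k)"

text \<open>The counterpart of the partial derivatives of a regular expression: the controls that
  can occur from \<open>p # k\<close> on until \<open>p\<close> is finished.\<close>

fun stacks :: "prog \<Rightarrow> prog list \<Rightarrow> prog list set" where
  "stacks (Act a) k = {Act a # k}"
| "stacks (p ;; q) k = insert ((p ;; q) # k) (stacks p (q # k) \<union> stacks q k)"
| "stacks (Alt p q) k = insert (Alt p q # k) (stacks p k \<union> stacks q k)"
| "stacks (Star p) k = insert (Star p # k) (stacks p (Star p # k))"

lemma finite_stacks: "finite (stacks p k)"
  by (induction p k rule: stacks.induct) auto

lemma start_in_stacks: "p # k \<in> stacks p k"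
  by (cases p) auto

lemma ctl_stacks: "\<kappa> \<in> stacks p k \<Longrightarrow> ctl \<kappa> a \<kappa>' \<Longrightarrow> \<kappa>' \<in> insert k (stacks p k)"
proof (induction p k arbitrary: \<kappa> \<kappa>' rule: stacks.induct)
  case (2 p q k)
  then show ?case using start_in_stacks[of p "q # k"] start_in_stacks[of q k]
    by (auto elim: ctl.cases)
next
  case (3 p q k)
  then show ?case using start_in_stacks[of p k] start_in_stacks[of q k]
    by (auto elim: ctl.cases)
next
  case (4 p k)
  then show ?case using start_in_stacks[of p "Star p # k"]
    by (auto elim: ctl.cases)
qed (auto elim: ctl.cases)

section \<open>Runs over control states\<close>

type_synonym conf = "prog list \<times> (nat \<Rightarrow> nat)"

definition run_step :: "(conf \<times> conf) set" where
  "run_step = {((k, s), (k', s')) | k s k' s'. \<exists>a. ctl k a k' \<and> asem a s s'}"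

fun ssem :: "prog list \<Rightarrow> ((nat \<Rightarrow> nat) \<times> (nat \<Rightarrow> nat)) set" where
  "ssem [] = {(s, s') . s' = s}"
| "ssem (p # k) = psem p O ssem k"

lemma ssem_Cons_iff [simp]:
  "(s, t) \<in> ssem (p # k) \<longleftrightarrow> (\<exists>u. (s, u) \<in> psem p \<and> (u, t) \<in> ssem k)"
  by auto

declare ssem.simps(2) [simp del]

lemma ctl_ssem: "ctl k a k' \<Longrightarrow> asem a s s' \<Longrightarrow> (s', t) \<in> ssem k' \<Longrightarrow> (s, t) \<in> ssem k"
proof (induction rule: ctl.induct)
  case (6 p k)
  then show ?case by (auto intro: converse_rtrancl_into_rtrancl)
qed auto

lemma run_psem: "((k, s), ([], t)) \<in> run_step\<^sup>* \<Longrightarrow> (s, t) \<in> ssem k"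
  by (induction "(k, s)" arbitrary: k s rule: converse_rtrancl_induct)
    (auto simp: run_step_def intro: ctl_ssem)

lemma run_stepI: "ctl k a k' \<Longrightarrow> asem a s s' \<Longrightarrow> ((k, s), (k', s')) \<in> run_step"
  by (auto simp: run_step_def)

lemma psem_run: "(s, s') \<in> psem p \<Longrightarrow> ((p # k, s), (k, s')) \<in> run_step\<^sup>*"
proof (induction p arbitrary: s s' k)
  case (Act a)
  then show ?case by (auto intro: run_stepI ctl.intros)
next
  case (Seq p q)
  then obtain t where "(s, t) \<in> psem p" "(t, s') \<in> psem q" by auto
  then have "((p # q # k, s), (k, s')) \<in> run_step\<^sup>*"
    using Seq.IH by (meson rtrancl_trans)
  moreover have "(((p ;; q) # k, s), (p # q # k, s)) \<in> run_step"
    by (rule run_stepI[OF ctl.intros(2)]) simp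
  ultimately show ?case by (rule converse_rtrancl_into_rtrancl[rotated])
next
  case (Alt p q)
  then consider "(s, s') \<in> psem p" | "(s, s') \<in> psem q" by auto
  then show ?case
  proof cases
    case 1
    have "((Alt p q # k, s), (p # k, s)) \<in> run_step"
      by (rule run_stepI[OF ctl.intros(3)]) simp
    with Alt.IH(1)[OF 1] show ?thesis by (rule converse_rtrancl_into_rtrancl[rotated])
  next
    case 2
    have "((Alt p q # k, s), (q # k, s)) \<in> run_step"
      by (rule run_stepI[OF ctl.intros(4)]) simp
    with Alt.IH(2)[OF 2] show ?thesis by (rule converse_rtrancl_into_rtrancl[rotated])
  qed
next
  case (Star p)
  then have "(s, s') \<in> (psem p)\<^sup>*" by simp
  then show ?case
  proof (induction rule: converse_rtrancl_induct)
    case base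
    show ?case by (rule r_into_rtrancl, rule run_stepI[OF ctl.intros(5)]) simp
  next
    case (step t t')
    have "((Star p # k, t), (p # Star p # k, t)) \<in> run_step"
      by (rule run_stepI[OF ctl.intros(6)]) simp
    with Star.IH[OF step.hyps(1), of "Star p # k"] step.IH show ?case
      by (meson converse_rtrancl_into_rtrancl rtrancl_trans)
  qed
qed

lemma run_iff_psem: "(([p], s), ([], s')) \<in> run_step\<^sup>* \<longleftrightarrow> (s, s') \<in> psem p"
  using run_psem[of "[p]" s s'] psem_run[of s s' p "[]"] by auto

section \<open>The cellular automaton\<close>

text \<open>A cell carries a fixed letter, the set of tracks on which it currently shows a pulse, and that
  set one time step earlier. Track 0 holds the clock, and track j + 1 holds register j: its pulses
  trail those of the clock by the value of the register. Pulses move one cell to the right per time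
  step, or per two time steps when they are taken from the second set, so that decrementing a
  register delays all other tracks. A failed test removes the clock. Track 1 of a \<open>Dbl\<close> cell is
  a flag that lets every second pulse pass.\<close>

datatype letter = Wall | Dbl | Ini | Tr "prog list" act "prog list" | Fin | Dc | En

type_synonym cell = "letter \<times> nat set \<times> nat set"

text \<open>The grammar of certificates: one \<open>Wall\<close>, any number of \<open>Dbl\<close>,
  an \<open>Ini\<close>, a chain of transitions from control \<open>[p]\<close> to control
  \<open>[]\<close>, a \<open>Fin\<close>, any number of \<open>Dc\<close>, an \<open>En\<close>. A
  wall may interrupt anywhere.\<close>

fun fits :: "prog \<Rightarrow> letter \<Rightarrow> letter \<Rightarrow> bool" where
  "fits p l Wall \<longleftrightarrow> True"
| "fits p l Dbl \<longleftrightarrow> l = Wall \<or> l = Dbl"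
| "fits p l Ini \<longleftrightarrow> l = Wall \<or> l = Dbl"
| "fits p l (Tr k a k') \<longleftrightarrow> ctl k a k' \<and> (l = Ini \<and> k = [p] \<or> (\<exists>k0 a0. l = Tr k0 a0 k))"
| "fits p l Fin \<longleftrightarrow> (\<exists>k0 a0. l = Tr k0 a0 [])"
| "fits p l Dc \<longleftrightarrow> l = Fin \<or> l = Dc"
| "fits p l En \<longleftrightarrow> l = Fin \<or> l = Dc"

text \<open>The sets \<open>c\<close> and \<open>d\<close> are the pulses of the left neighbour now
  and one step ago. \<open>Inc\<close> drops the clock pulse that follows a register pulse
  immediately, as the delay would reach the period; \<open>Dec\<close> drops one that coincides with
  a register pulse, as the delay is 0.\<close>

fun upd :: "act \<Rightarrow> nat set \<Rightarrow> nat set \<Rightarrow> nat set" where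
  "upd Skip c d = c"
| "upd (Zero j) c d = (if Suc j \<in> c then c else c - {0})"
| "upd (Inc j) c d = (c - {Suc j} - (if Suc j \<in> d then {0} else {})) \<union> (d \<inter> {Suc j})"
| "upd (Dec j) c d = (d - {Suc j} - (if Suc j \<in> d then {0} else {})) \<union> (c \<inter> {Suc j})"
| "upd (Copy i j) c d = (c - {Suc i}) \<union> (if Suc j \<in> c then {Suc i} else {})"
| "upd (Clr i) c d = (c - {Suc i}) \<union> (if 0 \<in> c then {Suc i} else {})"

text \<open>Starting all tracks together gives every register the value 0. \<open>Fin\<close>
  discards the tracks of the other registers, whose pulses would disturb the empty sets required by
  the test word.\<close>

fun out :: "letter \<Rightarrow> nat set \<Rightarrow> nat set \<Rightarrow> nat set \<Rightarrow> nat set" where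
  "out Wall c d own = {0}"
| "out Dbl c d own = (if 0 \<in> c \<and> 1 \<in> own then {0} else {}) \<union>
     (if (0 \<in> c) \<noteq> (1 \<in> own) then {1} else {})"
| "out Ini c d own = (if 0 \<in> c then UNIV else {})"
| "out (Tr k a k') c d own = upd a c d"
| "out Fin c d own = c \<inter> {0, 1}"
| "out Dc c d own = upd (Dec 0) c d"
| "out En c d own = (if 1 \<in> c then c \<inter> {0} else {})"

definition cell_rule :: "prog \<Rightarrow> nat \<Rightarrow> cell \<Rightarrow> cell \<Rightarrow> cell" where
  "cell_rule p N = (\<lambda>(l, c, d) (l', c', d').
     (l', if fits p l l' then out l' c d c' \<inter> {..N} else {}, c'))"

fun aregs :: "act \<Rightarrow> nat set" where
  "aregs Skip = {}"
| "aregs (Zero j) = {j}"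
| "aregs (Inc j) = {j}"
| "aregs (Dec j) = {j}"
| "aregs (Copy i j) = {i, j}"
| "aregs (Clr i) = {i}"

section \<open>Pulse trains modulo the period of the clock\<close>

fun offset :: "(nat \<Rightarrow> nat) \<Rightarrow> nat \<Rightarrow> nat" where
  "offset v 0 = 0"
| "offset v (Suc j) = v j"

text \<open>From time T on, each track in J carries an arithmetic progression of difference P:
  \<phi> is the phase of the clock and v the delays behind it. Delays below P are determined by the
  pulses.\<close>

definition stream :: "(nat \<Rightarrow> nat set) \<Rightarrow> nat \<Rightarrow> nat \<Rightarrow> (nat \<Rightarrow> nat) \<Rightarrow> nat set \<Rightarrow> nat \<Rightarrow> bool" where
  "stream C P \<phi> v J T \<longleftrightarrow> 0 < P \<and> (\<forall>j. Suc j \<in> J \<longrightarrow> v j < P) \<and>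
     (\<forall>t\<ge>T. C t = {x \<in> J. [t = \<phi> + offset v x] (mod P)})"

lemma streamD:
  "stream C P \<phi> v J T \<Longrightarrow> T \<le> t \<Longrightarrow> x \<in> C t \<longleftrightarrow> x \<in> J \<and> [t = \<phi> + offset v x] (mod P)"
  by (simp add: stream_def)

definition dead :: "(nat \<Rightarrow> nat set) \<Rightarrow> bool" where
  "dead C \<longleftrightarrow> (\<exists>T. \<forall>t\<ge>T. 0 \<notin> C t)"

lemma cong_offset_eq:
  "v < P \<Longrightarrow> w < P \<Longrightarrow> [\<phi> + v = \<phi> + w] (mod P) \<longleftrightarrow> v = (w :: nat)"
  by (simp add: cong_add_lcancel_nat) (simp add: cong_def)

lemma cong_Suc: "[Suc a = Suc b] (mod P) \<longleftrightarrow> [a = b] (mod P)"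
  using cong_add_lcancel_nat[of 1 a b P] by simp

lemma cong_same_time:
  assumes "v < P" "w < P" "[t = \<phi> + v] (mod P)"
  shows "[t = \<phi> + w] (mod P) \<longleftrightarrow> w = (v :: nat)"
  using assms cong_offset_eq[of v P w \<phi>] by (auto simp: cong_def)

lemma ge_Suc_Suc: "Suc (Suc T) \<le> t \<Longrightarrow> \<exists>t'. t = Suc (Suc t') \<and> T \<le> t'"
  by (metis Suc_le_D Suc_le_mono)

text \<open>The dichotomy behind the whole simulation. Tests are decided by coincidences of pulses,
  and these recur with period P: a test that fails removes every clock pulse, one that succeeds
  removes none.\<close>

lemma upd_stream:
  assumes C: "stream C P \<phi> v J T" and J: "0 \<in> J" "Suc ` aregs a \<subseteq> J"
    and C': "\<And>t. T \<le> t \<Longrightarrow> C' (Suc (Suc t)) = upd a (C (Suc t)) (C t)"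
  shows "(\<exists>\<phi>' v'. asem a v v' \<and> stream C' P \<phi>' v' J (Suc (Suc T)) \<and>
      (\<phi>' = (case a of Dec _ \<Rightarrow> \<phi> + 2 | _ \<Rightarrow> \<phi> + 1))) \<or>
    ((\<nexists>v'. asem a v v' \<and> (\<forall>j. Suc j \<in> J \<longrightarrow> v' j < P)) \<and> (\<forall>t\<ge>Suc (Suc T). 0 \<notin> C' t))"
proof -
  have P: "0 < P" and v: "\<And>j. Suc j \<in> J \<Longrightarrow> v j < P" using C by (auto simp: stream_def)
  have mem: "x \<in> C t \<longleftrightarrow> x \<in> J \<and> [t = \<phi> + offset v x] (mod P)" if "T \<le> t" for x t
    using streamD[OF C that] .
  have mem': "x \<in> C (Suc t) \<longleftrightarrow> x \<in> J \<and> [Suc (Suc t) = \<phi> + 1 + offset v x] (mod P)"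
    if "T \<le> t" for x t
    using mem[of "Suc t" x] that by (simp add: cong_Suc)
  have mem'': "x \<in> C t \<longleftrightarrow> x \<in> J \<and> [Suc (Suc t) = \<phi> + 2 + offset v x] (mod P)"
    if "T \<le> t" for x t
    using mem[of t x] that by (simp add: cong_Suc)
  have streamI: "stream C' P \<phi>' v' J (Suc (Suc T))"
    if "\<And>j. Suc j \<in> J \<Longrightarrow> v' j < P"
      "\<And>t x. T \<le> t \<Longrightarrow> x \<in> C' (Suc (Suc t)) \<longleftrightarrow> x \<in> J \<and> [Suc (Suc t) = \<phi>' + offset v' x] (mod P)"
    for \<phi>' v'
    unfolding stream_def using P that ge_Suc_Suc[of T] by fastforce
  have deadI: "\<forall>t\<ge>Suc (Suc T). 0 \<notin> C' t" if "\<And>t. T \<le> t \<Longrightarrow> 0 \<notin> C' (Suc (Suc t))"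
    using that ge_Suc_Suc[of T] by blast
  show ?thesis
  proof (cases a)
    case Skip
    then have "stream C' P (\<phi> + 1) v J (Suc (Suc T))"
      using v by (intro streamI) (auto simp: C' mem')
    then show ?thesis using Skip by auto
  next
    case (Zero j)
    then have j: "Suc j \<in> J" using J by auto
    show ?thesis
    proof (cases "v j = 0")
      case True
      have "stream C' P (\<phi> + 1) v J (Suc (Suc T))"
        using v Zero True j by (intro streamI) (auto simp: C' mem')
      then show ?thesis using Zero True by auto
    next
      case False
      have "\<forall>t\<ge>Suc (Suc T). 0 \<notin> C' t"
        using cong_same_time[of 0 P "v j" _ \<phi>] P v[OF j] False Zero j J(1)
        by (intro deadI) (auto simp: C' mem)
      then show ?thesis using Zero False by auto
    qed
  next
    case (Inc j)
    then have j: "Suc j \<in> J" using J by auto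
    \<comment> \<open>A register pulse just before a clock pulse signals overflow: one more unit of
      delay would be a full period.\<close>
    have test: "Suc j \<in> C t \<and> 0 \<in> C (Suc t) \<longleftrightarrow> 0 \<in> C (Suc t) \<and> Suc (v j) = P" if "T \<le> t" for t
    proof -
      have "[Suc t = \<phi> + 0] (mod P) \<Longrightarrow> [Suc t = \<phi> + Suc (v j)] (mod P) \<longleftrightarrow> Suc (v j) = P"
      proof (cases "Suc (v j) = P")
        case True
        then show "[Suc t = \<phi> + 0] (mod P) \<Longrightarrow> ?thesis"
          using cong_add_lcancel_nat[of \<phi> 0 P P] cong_trans by (fastforce simp: cong_def)
      next
        case False
        then show "[Suc t = \<phi> + 0] (mod P) \<Longrightarrow> ?thesis"
          using cong_same_time[of 0 P "Suc (v j)" "Suc t" \<phi>] v[OF j] by auto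
      qed
      then show ?thesis
        using mem[of t "Suc j"] mem[of "Suc t" 0] that j J(1) by (auto simp: cong_Suc)
    qed
    show ?thesis
    proof (cases "Suc (v j) = P")
      case True
      have "\<forall>t\<ge>Suc (Suc T). 0 \<notin> C' t"
        using test True Inc by (intro deadI) (auto simp: C')
      then show ?thesis using Inc True j by auto
    next
      case False
      have "x \<in> C' (Suc (Suc t)) \<longleftrightarrow>
          x \<in> J \<and> [Suc (Suc t) = \<phi> + 1 + offset (v(j := Suc (v j))) x] (mod P)" if "T \<le> t" for t x
      proof (cases "x = Suc j")
        case True
        then show ?thesis using that Inc j by (auto simp: C' mem'')
      next
        case xj: False
        have "x \<in> C' (Suc (Suc t)) \<longleftrightarrow> x \<in> C (Suc t)"
          using that Inc xj test[OF that] False by (cases "x = 0") (auto simp: C')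
        also have "offset (v(j := Suc (v j))) x = offset v x"
          using xj by (cases x) auto
        ultimately show ?thesis using mem'[OF that] by simp
      qed
      then have "stream C' P (\<phi> + 1) (v(j := Suc (v j))) J (Suc (Suc T))"
        using v False j by (intro streamI) (auto simp: Suc_lessI)
      then show ?thesis using Inc by auto
    qed
  next
    case (Dec j)
    then have j: "Suc j \<in> J" using J by auto
    have test: "Suc j \<in> C t \<and> 0 \<in> C t \<longleftrightarrow> 0 \<in> C t \<and> v j = 0" if "T \<le> t" for t
      using cong_same_time[of 0 P "v j" t \<phi>] P v[OF j] mem[OF that, of 0] mem[OF that, of "Suc j"] j J(1)
      by auto
    show ?thesis
    proof (cases "v j = 0")
      case True
      have "\<forall>t\<ge>Suc (Suc T). 0 \<notin> C' t"
        using test True Dec by (intro deadI) (auto simp: C')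
      then show ?thesis using Dec True by auto
    next
      case False
      have "x \<in> C' (Suc (Suc t)) \<longleftrightarrow>
          x \<in> J \<and> [Suc (Suc t) = \<phi> + 2 + offset (v(j := v j - 1)) x] (mod P)" if "T \<le> t" for t x
      proof (cases "x = Suc j")
        case True
        then show ?thesis using that Dec j False by (auto simp: C' mem')
      next
        case xj: False
        have "x \<in> C' (Suc (Suc t)) \<longleftrightarrow> x \<in> C t"
          using that Dec xj test[OF that] False by (cases "x = 0") (auto simp: C')
        also have "offset (v(j := v j - 1)) x = offset v x"
          using xj by (cases x) auto
        ultimately show ?thesis using mem''[OF that] by simp
      qed
      then have "stream C' P (\<phi> + 2) (v(j := v j - 1)) J (Suc (Suc T))"
        using v by (intro streamI) (auto simp: less_imp_diff_less)
      then show ?thesis using Dec False by auto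
    qed
  next
    case (Copy i j)
    then have ij: "Suc i \<in> J" "Suc j \<in> J" using J by auto
    have "x \<in> C' (Suc (Suc t)) \<longleftrightarrow>
        x \<in> J \<and> [Suc (Suc t) = \<phi> + 1 + offset (v(i := v j)) x] (mod P)" if "T \<le> t" for t x
      using that Copy ij by (cases x) (auto simp: C' mem')
    then have "stream C' P (\<phi> + 1) (v(i := v j)) J (Suc (Suc T))"
      using v ij by (intro streamI) auto
    then show ?thesis using Copy by auto
  next
    case (Clr i)
    then have i: "Suc i \<in> J" using J by auto
    have "x \<in> C' (Suc (Suc t)) \<longleftrightarrow>
        x \<in> J \<and> [Suc (Suc t) = \<phi> + 1 + offset (v(i := 0)) x] (mod P)" if "T \<le> t" for t x
      using that Clr i J(1) by (cases x) (auto simp: C' mem')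
    then have "stream C' P (\<phi> + 1) (v(i := 0)) J (Suc (Suc T))"
      using v P by (intro streamI) auto
    then show ?thesis using Clr by auto
  qed
qed

text \<open>The flag of the \<open>Dbl\<close> cell, the set B below, flips at every incoming pulse.\<close>

lemma double_period:
  assumes P: "0 < (P :: nat)" and A: "\<And>t. T \<le> t \<Longrightarrow> A t \<longleftrightarrow> [t = \<phi>] (mod P)"
    and B: "\<And>t. T \<le> t \<Longrightarrow> B (Suc t) \<longleftrightarrow> A t \<noteq> B t"
    and C: "\<And>t. T \<le> t \<Longrightarrow> C (Suc t) \<longleftrightarrow> A t \<and> B t"
  shows "\<exists>\<phi>' T'. \<forall>t\<ge>T'. C t \<longleftrightarrow> [t = \<phi>'] (mod 2 * P)"
proof -
  \<comment> \<open>A time of an incoming pulse, not before \<open>T\<close>.\<close>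
  define u where "u = \<phi> + P * T"
  have u: "T \<le> u" using P by (simp add: u_def trans_le_add2)
  have A': "A (u + s) \<longleftrightarrow> P dvd s" for s
  proof -
    have "A (u + s) \<longleftrightarrow> [\<phi> + s = \<phi> + 0] (mod P)"
      using A[of "u + s"] u mod_mult_self2[of "\<phi> + s" P T]
      by (simp add: u_def cong_def add.assoc add.commute[of s "P * T"])
    then show ?thesis by (simp only: cong_add_lcancel_nat cong_0_iff)
  qed
  \<comment> \<open>The pulses from time u to u + s number \<open>s div P + 1\<close>, and each of
    them flips the flag.\<close>
  have B': "B (u + Suc s) \<longleftrightarrow> (B u \<noteq> even (s div P))" for s
  proof (induction s)
    case 0
    show ?case using B[OF u] A'[of 0] by auto
  next
    case (Suc s)
    have "B (u + Suc (Suc s)) \<longleftrightarrow> (P dvd Suc s) \<noteq> B (u + Suc s)"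
      using B[of "u + Suc s"] u A'[of "Suc s"] by auto
    moreover have "Suc s div P = (if P dvd Suc s then Suc (s div P) else s div P)"
      by (simp add: div_Suc dvd_eq_mod_eq_0)
    ultimately show ?case using Suc.IH by auto
  qed
  have C': "C (Suc (u + P * m)) \<longleftrightarrow> (B u \<noteq> odd m)" for m
  proof (cases m)
    case 0
    then show ?thesis using C[OF u] A'[of 0] by auto
  next
    case (Suc k)
    then obtain s where s: "P * m = Suc s" using P by (cases "P * m") auto
    have "s div P = k"
    proof -
      have "P * k \<le> s" "s < P * Suc k" using s Suc P by auto
      then show ?thesis by (metis div_nat_eqI mult.commute)
    qed
    then show ?thesis
      using C[of "u + P * m"] u A'[of "P * m"] B'[of s] s Suc by auto
  qed
  \<comment> \<open>The flag at time u decides whether the pulse at u or the next one is the first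
    to pass.\<close>
  define \<phi>' where "\<phi>' = Suc u + (if B u then 0 else P)"
  have "C t \<longleftrightarrow> [t = \<phi>'] (mod 2 * P)" if t: "Suc u \<le> t" for t
  proof -
    obtain s where s: "t = Suc (u + s)" using t by (metis add_Suc le_Suc_ex)
    show ?thesis
    proof (cases "P dvd s")
      case True
      then obtain m where m: "s = P * m" ..
      have "[t = \<phi>'] (mod 2 * P) \<longleftrightarrow> [P * m = P * (if B u then 0 else 1)] (mod P * 2)"
        unfolding s m \<phi>'_def add_Suc cong_Suc
        by (simp only: cong_add_lcancel_nat mult.commute[of 2 P]) (simp add: if_distrib)
      also have "\<dots> \<longleftrightarrow> [m = (if B u then 0 else 1)] (mod 2)"
        using P by (simp only: cong_def mod_mult_mult1) simp
      also have "\<dots> \<longleftrightarrow> (B u \<noteq> odd m)"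
        by (auto simp: cong_def even_iff_mod_2_eq_zero odd_iff_mod_2_eq_one)
      finally show ?thesis using C'[of m] s m by simp
    next
      case False
      have "\<not> C t" using C[of "u + s"] u A'[of s] s False by auto
      moreover have "\<not> [t = \<phi>'] (mod 2 * P)"
      proof
        assume "[t = \<phi>'] (mod 2 * P)"
        then have "[u + s = u + (if B u then 0 else P)] (mod P)"
          unfolding s \<phi>'_def add_Suc cong_Suc by (rule cong_dvd_modulus_nat) simp
        then have "[s = (if B u then 0 else P)] (mod P)" by (simp only: cong_add_lcancel_nat)
        then show False using False by (auto simp: cong_def dvd_eq_mod_eq_0 split: if_splits)
      qed
      ultimately show ?thesis by simp
    qed
  qed
  then show ?thesis by blast
qed

section \<open>Space-time diagrams and the effect of each letter\<close>

definition trace :: "prog \<Rightarrow> nat \<Rightarrow> (nat \<Rightarrow> int \<Rightarrow> cell) \<Rightarrow> bool" where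
  "trace p N X \<longleftrightarrow> (\<forall>t i. X (Suc t) i = cell_rule p N (X t (i - 1)) (X t i))"

definition letter :: "(nat \<Rightarrow> int \<Rightarrow> cell) \<Rightarrow> int \<Rightarrow> letter" where
  "letter X i = fst (X 0 i)"

definition cur :: "(nat \<Rightarrow> int \<Rightarrow> cell) \<Rightarrow> int \<Rightarrow> nat \<Rightarrow> nat set" where
  "cur X i t = fst (snd (X t i))"

lemma fst_cell_rule [simp]: "fst (cell_rule p N x y) = fst y"
  by (simp add: cell_rule_def split: prod.splits)

lemma trace_letter: "trace p N X \<Longrightarrow> fst (X t i) = letter X i"
  by (induction t) (simp_all add: trace_def letter_def)

lemma trace_prev: "trace p N X \<Longrightarrow> snd (snd (X (Suc t) i)) = cur X i t"
  by (simp add: trace_def cell_rule_def cur_def split: prod.splits)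

lemma trace_cell: "trace p N X \<Longrightarrow> X (Suc t) i = (letter X i, cur X i (Suc t), cur X i t)"
  using trace_letter[of p N X "Suc t" i] trace_prev[of p N X t i]
  by (simp add: cur_def prod_eq_iff)

text \<open>Valid from time 2 on, because the remembered sets of the initial configuration are
  arbitrary and become correct at time 1.\<close>

lemma trace_cur:
  assumes "trace p N X"
  shows "cur X i (Suc (Suc t)) = (if fits p (letter X (i - 1)) (letter X i)
    then out (letter X i) (cur X (i - 1) (Suc t)) (cur X (i - 1) t) (cur X i (Suc t)) \<inter> {..N} else {})"
proof -
  have "X (Suc (Suc t)) i = cell_rule p N (X (Suc t) (i - 1)) (X (Suc t) i)"
    using assms by (simp add: trace_def)
  then show ?thesis
    using trace_cell[OF assms, of t "i - 1"] trace_cell[OF assms, of t i]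
    by (simp add: cell_rule_def cur_def[of X i "Suc (Suc t)"])
qed

lemma trace_cur_fits:
  assumes "trace p N X" "letter X i = l" "fits p (letter X (i - 1)) l"
  shows "cur X i (Suc (Suc t)) =
    out l (cur X (i - 1) (Suc t)) (cur X (i - 1) t) (cur X i (Suc t)) \<inter> {..N}"
  using trace_cur[OF assms(1), of i t] assms(2,3) by (simp only: if_True)

text \<open>Only the clock is described, since track 1 of a \<open>Dbl\<close> cell holds the flag
  instead of a register.\<close>

definition pulses :: "(nat \<Rightarrow> nat set) \<Rightarrow> nat \<Rightarrow> bool" where
  "pulses C P \<longleftrightarrow> 0 < P \<and> (\<exists>\<phi> T. \<forall>t\<ge>T. 0 \<in> C t \<longleftrightarrow> [t = \<phi>] (mod P))"

lemma wall_pulses: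
  assumes "trace p N X" "letter X i = Wall"
  shows "pulses (cur X i) 1"
proof -
  have "0 \<in> cur X i t" if t: "Suc (Suc 0) \<le> t" for t
    using ge_Suc_Suc[OF t] trace_cur[OF assms(1)] assms(2) by auto
  then show ?thesis
    unfolding pulses_def by (intro conjI exI[of _ 0] exI[of _ "Suc (Suc 0)"]) auto
qed

lemma dbl_pulses:
  assumes tr: "trace p N X" and N: "0 < N" and l: "letter X i = Dbl" "letter X (i - 1) \<in> {Wall, Dbl}"
    and P: "pulses (cur X (i - 1)) P"
  shows "pulses (cur X i) (2 * P)"
proof -
  from P obtain \<phi> T where "0 < P" and A: "\<And>t. T \<le> t \<Longrightarrow> 0 \<in> cur X (i - 1) t \<longleftrightarrow> [t = \<phi>] (mod P)"
    unfolding pulses_def by blast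
  have c: "cur X i (Suc t) = out Dbl (cur X (i - 1) t) {} (cur X i t)" if t: "Suc T \<le> t" for t
  proof -
    obtain t' where "t = Suc t'" using t by (cases t) auto
    then show ?thesis using trace_cur[OF tr, of i t'] l N by auto
  qed
  have "\<exists>\<phi>' T'. \<forall>t\<ge>T'. 0 \<in> cur X i t \<longleftrightarrow> [t = \<phi>'] (mod 2 * P)"
  proof (rule double_period[OF \<open>0 < P\<close>, where T = "Suc T" and \<phi> = \<phi> and
        A = "\<lambda>t. 0 \<in> cur X (i - 1) t" and B = "\<lambda>t. 1 \<in> cur X i t"])
    show "0 \<in> cur X (i - 1) t \<longleftrightarrow> [t = \<phi>] (mod P)" if "Suc T \<le> t" for t
      using A[of t] that by simp
    show "1 \<in> cur X i (Suc t) \<longleftrightarrow> (0 \<in> cur X (i - 1) t) \<noteq> (1 \<in> cur X i t)" if "Suc T \<le> t" for t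
      unfolding c[OF that] by simp
    show "0 \<in> cur X i (Suc t) \<longleftrightarrow> 0 \<in> cur X (i - 1) t \<and> 1 \<in> cur X i t" if "Suc T \<le> t" for t
      unfolding c[OF that] by simp
  qed
  with \<open>0 < P\<close> show ?thesis by (simp add: pulses_def)
qed

lemma ini_stream:
  assumes tr: "trace p N X" and l: "letter X i = Ini" "letter X (i - 1) \<in> {Wall, Dbl}"
    and P: "pulses (cur X (i - 1)) P"
  shows "\<exists>\<phi> T. stream (cur X i) P \<phi> (\<lambda>_. 0) {..N} T"
proof -
  from P obtain \<phi> T where "0 < P" and A: "\<And>t. T \<le> t \<Longrightarrow> 0 \<in> cur X (i - 1) t \<longleftrightarrow> [t = \<phi>] (mod P)"
    unfolding pulses_def by blast
  have off: "offset (\<lambda>_. 0) x = 0" for x by (cases x) auto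
  have "cur X i t = {x \<in> {..N}. [t = Suc \<phi>] (mod P)}" if t: "Suc (Suc T) \<le> t" for t
  proof -
    obtain t' where t': "t = Suc (Suc t')" "T \<le> t'" using ge_Suc_Suc[OF t] by blast
    have "cur X i t = (if 0 \<in> cur X (i - 1) (Suc t') then {..N} else {})"
      using trace_cur[OF tr, of i t'] l t' by auto
    with A[of "Suc t'"] t' show ?thesis by (simp add: cong_Suc atMost_def)
  qed
  then have "stream (cur X i) P (Suc \<phi>) (\<lambda>_. 0) {..N} (Suc (Suc T))"
    using \<open>0 < P\<close> by (simp add: stream_def off)
  then show ?thesis by blast
qed

lemma stream_subset: "stream C P \<phi> v J T \<Longrightarrow> T \<le> t \<Longrightarrow> C t \<subseteq> J"
  using streamD[of C P \<phi> v J T t] by blast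

lemma upd_subset: "c \<subseteq> J \<Longrightarrow> d \<subseteq> J \<Longrightarrow> Suc ` aregs a \<subseteq> J \<Longrightarrow> upd a c d \<subseteq> J"
  by (cases a) auto

lemma tr_stream:
  assumes tr: "trace p N X" and l: "letter X i = Tr k a k'" "fits p (letter X (i - 1)) (Tr k a k')"
    and a: "aregs a \<subseteq> {..<N}" and C: "stream (cur X (i - 1)) P \<phi> v {..N} T"
  shows "(\<exists>\<phi>' v' T'. asem a v v' \<and> stream (cur X i) P \<phi>' v' {..N} T') \<or>
    ((\<nexists>v'. asem a v v' \<and> (\<forall>j<N. v' j < P)) \<and> dead (cur X i))"
proof -
  have a': "Suc ` aregs a \<subseteq> {..N}" using a by auto
  have "cur X i (Suc (Suc t)) = upd a (cur X (i - 1) (Suc t)) (cur X (i - 1) t)" if "T \<le> t" for t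
  proof -
    have "upd a (cur X (i - 1) (Suc t)) (cur X (i - 1) t) \<subseteq> {..N}"
      using that a' by (intro upd_subset stream_subset[OF C]) auto
    then show ?thesis unfolding trace_cur_fits[OF tr l] out.simps by blast
  qed
  from upd_stream[OF C _ a' this] have "(\<exists>\<phi>' v'. asem a v v' \<and>
        stream (cur X i) P \<phi>' v' {..N} (Suc (Suc T))) \<or>
      ((\<nexists>v'. asem a v v' \<and> (\<forall>j. Suc j \<in> {..N} \<longrightarrow> v' j < P)) \<and>
        (\<forall>t\<ge>Suc (Suc T). 0 \<notin> cur X i t))"
    by blast
  moreover have "(\<forall>j. Suc j \<in> {..N} \<longrightarrow> v' j < P) \<longleftrightarrow> (\<forall>j<N. v' j < P)" for v' :: "nat \<Rightarrow> nat"
    by (simp add: Suc_le_eq)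
  ultimately show ?thesis unfolding dead_def by metis
qed

lemma fin_stream:
  assumes tr: "trace p N X" and N: "0 < N" and l: "letter X i = Fin" "letter X (i - 1) = Tr k a []"
    and C: "stream (cur X (i - 1)) P \<phi> v {..N} T"
  shows "stream (cur X i) P (\<phi> + 1) v {0, 1} (Suc (Suc T))"
proof -
  have "cur X i t = {x \<in> {0, 1}. [t = \<phi> + 1 + offset v x] (mod P)}" if t: "Suc (Suc T) \<le> t" for t
  proof -
    obtain t' where t': "t = Suc (Suc t')" "T \<le> t'" using ge_Suc_Suc[OF t] by blast
    have fit: "fits p (letter X (i - 1)) Fin" using l(2) by simp
    have "x \<in> cur X (i - 1) (Suc t') \<longleftrightarrow> [t = \<phi> + 1 + offset v x] (mod P)" if "x \<in> {0, 1}" for x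
      using streamD[OF C, of "Suc t'" x] t' N that by (auto simp: cong_Suc)
    moreover have "cur X i t = cur X (i - 1) (Suc t') \<inter> {0, 1}"
      unfolding t'(1) trace_cur_fits[OF tr l(1) fit] out.simps using N by auto
    ultimately show ?thesis by blast
  qed
  then show ?thesis using C N by (auto simp: stream_def)
qed

lemma dc_stream:
  assumes tr: "trace p N X" and N: "0 < N" and l: "letter X i = Dc" "letter X (i - 1) \<in> {Fin, Dc}"
    and C: "stream (cur X (i - 1)) P \<phi> v {0, 1} T"
  shows "v 0 \<noteq> 0 \<and> stream (cur X i) P (\<phi> + 2) (v(0 := v 0 - 1)) {0, 1} (Suc (Suc T)) \<or>
    v 0 = 0 \<and> dead (cur X i)"
proof -
  have "cur X i (Suc (Suc t)) = upd (Dec 0) (cur X (i - 1) (Suc t)) (cur X (i - 1) t)" if "T \<le> t" for t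
  proof -
    have "upd (Dec 0) (cur X (i - 1) (Suc t)) (cur X (i - 1) t) \<subseteq> {0, 1}"
      using that by (intro upd_subset stream_subset[OF C]) auto
    also have "{0, 1} \<subseteq> {..N}" using N by auto
    finally have "upd (Dec 0) (cur X (i - 1) (Suc t)) (cur X (i - 1) t) \<subseteq> {..N}" .
    moreover have "fits p (letter X (i - 1)) Dc" using l(2) by simp
    ultimately show ?thesis unfolding trace_cur_fits[OF tr l(1) \<open>fits p _ Dc\<close>] out.simps by blast
  qed
  from upd_stream[OF C _ _ this]
  have "(\<exists>v'. asem (Dec 0) v v' \<and> stream (cur X i) P (\<phi> + 2) v' {0, 1} (Suc (Suc T))) \<or>
      ((\<nexists>v'. asem (Dec 0) v v' \<and> (\<forall>j. Suc j \<in> {0, 1} \<longrightarrow> v' j < P)) \<and>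
        (\<forall>t\<ge>Suc (Suc T). 0 \<notin> cur X i t))"
    by auto
  then show ?thesis
  proof (elim disjE conjE)
    assume no: "\<nexists>v'. asem (Dec 0) v v' \<and> (\<forall>j. Suc j \<in> {0, 1} \<longrightarrow> v' j < P)"
      and "\<forall>t\<ge>Suc (Suc T). 0 \<notin> cur X i t"
    then have "dead (cur X i)" unfolding dead_def by blast
    moreover have "v 0 < P" using C by (simp add: stream_def)
    with no have "v 0 = 0" by (auto simp: less_imp_diff_less)
    ultimately show ?thesis by blast
  qed auto
qed

lemma en_stream:
  assumes tr: "trace p N X" and l: "letter X i = En" "letter X (i - 1) \<in> {Fin, Dc}"
    and C: "stream (cur X (i - 1)) P \<phi> v {0, 1} T"
  shows "v 0 = 0 \<and> stream (cur X i) P (\<phi> + 1) v {0} (Suc (Suc T)) \<or> v 0 \<noteq> 0 \<and> dead (cur X i)"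
proof -
  have P: "0 < P" "v 0 < P" using C by (auto simp: stream_def)
  have c: "cur X i (Suc (Suc t)) = (if [Suc t = \<phi>] (mod P) \<and> v 0 = 0 then {0} else {})"
    if "T \<le> t" for t
  proof -
    have "1 \<in> cur X (i - 1) (Suc t) \<and> 0 \<in> cur X (i - 1) (Suc t) \<longleftrightarrow> [Suc t = \<phi>] (mod P) \<and> v 0 = 0"
      using streamD[OF C, of "Suc t"] that cong_same_time[of 0 P "v 0" "Suc t" \<phi>] P by auto
    moreover have "fits p (letter X (i - 1)) En" using l(2) by simp
    ultimately show ?thesis
      unfolding trace_cur_fits[OF tr l(1) \<open>fits p _ En\<close>] out.simps by auto
  qed
  show ?thesis
  proof (cases "v 0 = 0")
    case True
    have "cur X i t = {x \<in> {0}. [t = \<phi> + 1 + offset v x] (mod P)}" if t: "Suc (Suc T) \<le> t" for t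
      using ge_Suc_Suc[OF t] c True by (auto simp: cong_Suc split: if_splits)
    with True P show ?thesis by (auto simp: stream_def)
  next
    case False
    have "0 \<notin> cur X i t" if t: "Suc (Suc T) \<le> t" for t
      using ge_Suc_Suc[OF t] c False by auto
    with False show ?thesis by (auto simp: dead_def)
  qed
qed

text \<open>Clock pulses are created by walls alone; all other letters delay or drop those of the
  left neighbour.\<close>

lemma dead_propagates:
  assumes tr: "trace p N X" and l: "letter X i \<noteq> Wall" and C: "dead (cur X (i - 1))"
  shows "dead (cur X i)"
proof -
  obtain T where T: "\<And>t. T \<le> t \<Longrightarrow> 0 \<notin> cur X (i - 1) t"
    using C by (auto simp: dead_def)
  have "0 \<notin> upd a c d" if "0 \<notin> c" "0 \<notin> d" for a c d
    using that by (cases a) auto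
  then have "0 \<notin> out (letter X i) c d own" if "0 \<notin> c" "0 \<notin> d" for c d own
    using that l by (cases "letter X i") (auto simp del: upd.simps)
  then have "0 \<notin> cur X i t" if t: "Suc (Suc T) \<le> t" for t
    using ge_Suc_Suc[OF t] trace_cur[OF tr, of i] T by (auto split: if_splits)
  then show ?thesis by (auto simp: dead_def)
qed

lemma unfit_dead:
  assumes "trace p N X" "\<not> fits p (letter X (i - 1)) (letter X i)"
  shows "dead (cur X i)"
  unfolding dead_def
  using trace_cur[OF assms(1), of i] assms(2)
  by (intro exI[of _ "Suc (Suc 0)"]) (auto dest: ge_Suc_Suc)

section \<open>What a surviving clock certifies\<close>

abbreviation reaches :: "prog \<Rightarrow> prog list \<Rightarrow> (nat \<Rightarrow> nat) \<Rightarrow> bool" where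
  "reaches p k v \<equiv> (([p], \<lambda>_. 0), (k, v)) \<in> run_step\<^sup>*"

definition countdown :: "(nat \<Rightarrow> int \<Rightarrow> cell) \<Rightarrow> int \<Rightarrow> nat \<Rightarrow> bool" where
  "countdown X i m \<longleftrightarrow> letter X (i - int m) = Fin \<and> (\<forall>j<m. letter X (i - int j) = Dc)"

text \<open>Up to the last transition the delays are the registers of a run of the program. Over the
  countdown \<open>v\<close> stays the final state of that run and \<open>w\<close> is what remains;
  at \<open>En\<close> the number of \<open>Dc\<close> cells has absorbed all of
  \<open>v 0\<close>.\<close>

fun cell_inv :: "prog \<Rightarrow> nat \<Rightarrow> (nat \<Rightarrow> int \<Rightarrow> cell) \<Rightarrow> int \<Rightarrow> letter \<Rightarrow> bool" where
  "cell_inv p N X i Ini \<longleftrightarrow> (\<exists>P \<phi> T. stream (cur X i) P \<phi> (\<lambda>_. 0) {..N} T)"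
| "cell_inv p N X i (Tr k a k') \<longleftrightarrow> (\<exists>P \<phi> v T. reaches p k' v \<and> stream (cur X i) P \<phi> v {..N} T)"
| "cell_inv p N X i En \<longleftrightarrow> (\<exists>v. reaches p [] v \<and> countdown X (i - 1) (v 0))"
| "cell_inv p N X i l \<longleftrightarrow> (if l \<in> {Fin, Dc}
     then \<exists>P \<phi> v w T m. reaches p [] v \<and> countdown X i m \<and> v 0 = w 0 + m \<and> stream (cur X i) P \<phi> w {0, 1} T
     else \<exists>P. pulses (cur X i) P)"

lemma countdown_Suc: "letter X i = Dc \<Longrightarrow> countdown X (i - 1) m \<Longrightarrow> countdown X i (Suc m)"
  unfolding countdown_def by (auto simp: less_Suc_eq_0_disj algebra_simps)

text \<open>A failed test or a misfit kills the clock, a dead clock stays dead, and only a wall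
  starts afresh; so each living cell inherits its claim from a living left neighbour.\<close>

lemma cell_inv_step:
  assumes tr: "trace p N X" and N: "0 < N"
    and regs: "\<And>k a k'. letter X i = Tr k a k' \<Longrightarrow> aregs a \<subseteq> {..<N}"
    and left: "dead (cur X (i - 1)) \<or> cell_inv p N X (i - 1) (letter X (i - 1))"
  shows "dead (cur X i) \<or> cell_inv p N X i (letter X i)"
proof (cases "letter X i = Wall")
  case True
  then show ?thesis using wall_pulses[OF tr True] by auto
next
  case nw: False
  show ?thesis
  proof (cases "dead (cur X (i - 1)) \<or> \<not> fits p (letter X (i - 1)) (letter X i)")
    case True
    then show ?thesis using dead_propagates[OF tr nw] unfit_dead[OF tr] by blast
  next
    case False
    then have fit: "fits p (letter X (i - 1)) (letter X i)"
      and li: "cell_inv p N X (i - 1) (letter X (i - 1))"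
      using left by auto
    show ?thesis
    proof (cases "letter X i")
      case Wall
      with nw show ?thesis by simp
    next
      case Dbl
      with fit have l: "letter X (i - 1) \<in> {Wall, Dbl}" by simp
      with li obtain P where "pulses (cur X (i - 1)) P" by auto
      from dbl_pulses[OF tr N Dbl l this] Dbl show ?thesis by auto
    next
      case Ini
      with fit have l: "letter X (i - 1) \<in> {Wall, Dbl}" by simp
      with li obtain P where "pulses (cur X (i - 1)) P" by auto
      from ini_stream[OF tr Ini l this] Ini show ?thesis by auto
    next
      case (Tr k a k')
      from fit[unfolded Tr] consider "letter X (i - 1) = Ini" "k = [p]"
        | k0 a0 where "letter X (i - 1) = Tr k0 a0 k" by auto
      then obtain P \<phi> v T where run: "reaches p k v" and C: "stream (cur X (i - 1)) P \<phi> v {..N} T"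
      proof cases
        case 1
        then have "reaches p k (\<lambda>_. 0)" by simp
        with li 1 that show ?thesis by auto
      next
        case 2
        with li that show ?thesis by auto
      qed
      have "reaches p k' v'" if "asem a v v'" for v'
        using run run_stepI[of k a k' v v'] that fit unfolding Tr
        by (simp add: rtrancl.rtrancl_into_rtrancl)
      then show ?thesis
        using tr_stream[OF tr Tr fit[unfolded Tr] regs[OF Tr] C] unfolding Tr by fastforce
    next
      case Fin
      then obtain k a where l: "letter X (i - 1) = Tr k a []" using fit by auto
      with li obtain P \<phi> v T where "reaches p [] v" "stream (cur X (i - 1)) P \<phi> v {..N} T" by auto
      moreover have "countdown X i 0" using Fin by (simp add: countdown_def)
      ultimately show ?thesis
        using fin_stream[OF tr N Fin l] Fin by fastforce
    next
      case Dc
      with fit have l: "letter X (i - 1) \<in> {Fin, Dc}" by simp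
      then obtain P \<phi> v w T m where *: "reaches p [] v" "countdown X (i - 1) m" "v 0 = w 0 + m"
        "stream (cur X (i - 1)) P \<phi> w {0, 1} T"
        using li by auto
      from dc_stream[OF tr N Dc l *(4)] show ?thesis
      proof
        assume w: "w 0 \<noteq> 0 \<and> stream (cur X i) P (\<phi> + 2) (w(0 := w 0 - 1)) {0, 1} (Suc (Suc T))"
        with * have "\<exists>P \<phi> v w T m. reaches p [] v \<and> countdown X i m \<and> v 0 = w 0 + m \<and>
            stream (cur X i) P \<phi> w {0, 1} T"
          by (intro exI[of _ P] exI[of _ "\<phi> + 2"] exI[of _ v] exI[of _ "w(0 := w 0 - 1)"]
              exI[of _ "Suc (Suc T)"] exI[of _ "Suc m"]) (auto intro: countdown_Suc[OF Dc])
        then show ?thesis unfolding Dc by simp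
      qed auto
    next
      case En
      with fit have l: "letter X (i - 1) \<in> {Fin, Dc}" by simp
      then obtain P \<phi> v w T m where *: "reaches p [] v" "countdown X (i - 1) m" "v 0 = w 0 + m"
        "stream (cur X (i - 1)) P \<phi> w {0, 1} T"
        using li by auto
      from en_stream[OF tr En l *(4)] * show ?thesis unfolding En by auto
    qed
  qed
qed

text \<open>The pulse of the last cell is observed one time step late: by then it has left the set of
  earlier pulses of all other cells.\<close>

definition test_word :: "nat \<Rightarrow> cell list" where
  "test_word n = (Fin, {}, {}) # replicate n (Dc, {}, {}) @ [(En, {}, {0})]"

lemma length_test_word: "length (test_word n) = n + 2"
  by (simp add: test_word_def)

lemma test_word_nth:
  "test_word n ! 0 = (Fin, {}, {})"
  "j < n \<Longrightarrow> test_word n ! Suc j = (Dc, {}, {})"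
  "test_word n ! Suc n = (En, {}, {0})"
  by (auto simp: test_word_def nth_append)

text \<open>The invariant travels from the wall to the last cell, where infinitely many occurrences
  exclude a dead clock. What survives there names a run and a countdown of matching length.\<close>

lemma test_word_sound:
  assumes tr: "trace p N X" and N: "0 < N"
    and regs: "\<And>i k a k'. letter X i = Tr k a k' \<Longrightarrow> aregs a \<subseteq> {..<N}"
    and w: "w \<le> 0" "letter X w = Wall"
    and inf: "\<forall>T. \<exists>t\<ge>T. \<forall>j<n + 2. X t (int j) = test_word n ! j"
  shows "\<exists>v. reaches p [] v \<and> v 0 = n"
proof -
  have "dead (cur X (w + int m)) \<or> cell_inv p N X (w + int m) (letter X (w + int m))" for m
  proof (induction m)
    case 0
    have "cell_inv p N X w (letter X w)" using wall_pulses[OF tr w(2)] w(2) by auto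
    then show ?case by simp
  next
    case (Suc m)
    have eq: "w + int (Suc m) - 1 = w + int m" by simp
    show ?case
      by (rule cell_inv_step[OF tr N]) (rule regs, assumption, unfold eq, rule Suc.IH)
  qed
  moreover have "w + int (nat (int (Suc n) - w)) = int (Suc n)" using w(1) by simp
  ultimately have inv: "dead (cur X (int (Suc n))) \<or>
      cell_inv p N X (int (Suc n)) (letter X (int (Suc n)))"
    by metis
  obtain t0 where t0: "\<forall>j<n + 2. X t0 (int j) = test_word n ! j" using inf by blast
  have let_eq: "letter X (int j) = fst (test_word n ! j)" if "j < n + 2" for j
    using t0 that trace_letter[OF tr, of t0 "int j"] by simp
  have En: "letter X (int (Suc n)) = En"
    using let_eq[of "Suc n"] by (simp add: test_word_nth)
  have "\<not> dead (cur X (int (Suc n)))"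
  proof
    assume "dead (cur X (int (Suc n)))"
    then obtain T where T: "\<And>t. T \<le> t \<Longrightarrow> 0 \<notin> cur X (int (Suc n)) t"
      by (auto simp: dead_def)
    \<comment> \<open>One step later than \<open>T\<close>, since the word shows the pulse of the
      previous time.\<close>
    obtain t where t: "Suc T \<le> t" "X t (int (Suc n)) = test_word n ! Suc n"
      using inf[rule_format, of "Suc T"] by auto
    then obtain t' where t': "t = Suc t'" "T \<le> t'" by (metis Suc_le_D Suc_le_mono)
    have "cur X (int (Suc n)) t' = {0}"
      using trace_prev[OF tr, of t' "int (Suc n)"] t(2) t'(1) by (simp add: test_word_nth)
    with T[OF t'(2)] show False by simp
  qed
  with inv En obtain v where v: "reaches p [] v" "countdown X (int n) (v 0)" by auto
  have letters: "letter X 0 = Fin" "0 < j \<Longrightarrow> j \<le> n \<Longrightarrow> letter X (int j) = Dc" for j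
    using let_eq[of 0] let_eq[of j] test_word_nth(2)[of "j - 1" n] by (simp_all add: test_word_nth)
  \<comment> \<open>A shorter countdown would need \<open>Fin\<close> where the word has
    \<open>Dc\<close>, a longer one would need \<open>Dc\<close> at cell 0.\<close>
  have "v 0 = n"
  proof (cases "v 0" n rule: linorder_cases)
    case less
    then have "letter X (int n - int (v 0)) = Dc" using letters(2)[of "n - v 0"] by (simp add: of_nat_diff)
    with v(2) show ?thesis by (simp add: countdown_def)
  next
    case greater
    then have "letter X (int n - int n) = Dc" using v(2) unfolding countdown_def by blast
    with letters(1) show ?thesis by simp
  qed
  with v(1) show ?thesis by blast
qed

section \<open>Words that spell out a run\<close>

definition matches :: "(nat \<Rightarrow> int \<Rightarrow> cell) \<Rightarrow> int \<Rightarrow> letter list \<Rightarrow> bool" where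
  "matches X a ls \<longleftrightarrow> (\<forall>j<length ls. letter X (a + int j) = ls ! j)"

lemma matches_append:
  "matches X a (ls @ ms) \<longleftrightarrow> matches X a ls \<and> matches X (a + int (length ls)) ms"
proof
  assume *: "matches X a (ls @ ms)"
  have "letter X (a + int (length ls) + int j) = ms ! j" if "j < length ms" for j
    using *[unfolded matches_def, rule_format, of "length ls + j"] that
    by (simp add: nth_append algebra_simps)
  moreover have "letter X (a + int j) = ls ! j" if "j < length ls" for j
    using *[unfolded matches_def, rule_format, of j] that by (simp add: nth_append)
  ultimately show "matches X a ls \<and> matches X (a + int (length ls)) ms"
    by (simp add: matches_def)
next
  assume *: "matches X a ls \<and> matches X (a + int (length ls)) ms"
  have "letter X (a + int j) = (ls @ ms) ! j" if "j < length (ls @ ms)" for j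
  proof (cases "j < length ls")
    case True
    then show ?thesis using * by (simp add: matches_def nth_append)
  next
    case False
    then have "a + int (length ls) + int (j - length ls) = a + int j" by simp
    then show ?thesis
      using False that conjunct2[OF *, unfolded matches_def, rule_format, of "j - length ls"]
      by (simp add: nth_append)
  qed
  then show "matches X a (ls @ ms)" by (simp add: matches_def)
qed

lemma matches_Cons: "matches X a (l # ls) \<longleftrightarrow> letter X a = l \<and> matches X (a + 1) ls"
  using matches_append[of X a "[l]" ls] by (simp add: matches_def)

lemma matches_last: "matches X a ls \<Longrightarrow> ls \<noteq> [] \<Longrightarrow> letter X (a + int (length ls) - 1) = last ls"
  by (cases ls rule: rev_cases) (auto simp: matches_append matches_Cons)

text \<open>Neither the cells left of the word nor the initial pulse sets matter: they may change
  only the phase and the settling time.\<close>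

definition carries :: "prog \<Rightarrow> nat \<Rightarrow> letter list \<Rightarrow> nat \<Rightarrow> (nat \<Rightarrow> nat) \<Rightarrow> bool" where
  "carries p N ls P v \<longleftrightarrow> (\<forall>X a. trace p N X \<longrightarrow> matches X a ls \<longrightarrow>
     (\<exists>\<phi> T. stream (cur X (a + int (length ls) - 1)) P \<phi> v {..N} T))"

lemma doubling_chain:
  assumes "trace p N X" "0 < N" "matches X a (Wall # replicate m Dbl)"
  shows "pulses (cur X (a + int m)) (2 ^ m)"
  using assms(3)
proof (induction m)
  case 0
  then show ?case using wall_pulses[OF assms(1)] by (simp add: matches_Cons)
next
  case (Suc m)
  have "matches X a ((Wall # replicate m Dbl) @ [Dbl])"
    using Suc.prems by (simp add: replicate_append_same)
  then have m: "matches X a (Wall # replicate m Dbl)" and l: "letter X (a + int (Suc m)) = Dbl"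
    unfolding matches_append by (simp_all add: matches_Cons algebra_simps)
  have eq: "a + int (Suc m) - 1 = a + int m" by simp
  have "letter X (a + int m) \<in> {Wall, Dbl}"
    using matches_last[OF m] by (auto split: if_splits)
  with dbl_pulses[OF assms(1,2) l, unfolded eq] Suc.IH[OF m] show ?case by simp
qed

lemma carries_ini:
  assumes "0 < N"
  shows "carries p N (Wall # replicate m Dbl @ [Ini]) (2 ^ m) (\<lambda>_. 0)"
  unfolding carries_def
proof (intro allI impI)
  fix X a
  assume tr: "trace p N X" and *: "matches X a (Wall # replicate m Dbl @ [Ini])"
  then have "matches X a ((Wall # replicate m Dbl) @ [Ini])" by simp
  then have m: "matches X a (Wall # replicate m Dbl)" and l: "letter X (a + int (Suc m)) = Ini"
    unfolding matches_append by (simp_all add: matches_Cons algebra_simps)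
  have eq: "a + int (Suc m) - 1 = a + int m" by simp
  have "letter X (a + int m) \<in> {Wall, Dbl}"
    using matches_last[OF m] by (auto split: if_splits)
  with ini_stream[OF tr l, unfolded eq] doubling_chain[OF tr assms m]
  have "\<exists>\<phi> T. stream (cur X (a + int (Suc m))) (2 ^ m) \<phi> (\<lambda>_. 0) {..N} T" by blast
  moreover have "a + int (length (Wall # replicate m Dbl @ [Ini])) - 1 = a + int (Suc m)" by simp
  ultimately show "\<exists>\<phi> T. stream (cur X (a + int (length (Wall # replicate m Dbl @ [Ini])) - 1))
      (2 ^ m) \<phi> (\<lambda>_. 0) {..N} T"
    by metis
qed

text \<open>The bound on \<open>v'\<close> excludes the dead alternative of
  \<open>tr_stream\<close>, and actions are functional, so the new delays must be
  \<open>v'\<close>.\<close>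

lemma carries_snoc:
  assumes c: "carries p N ls P v" and ls: "ls \<noteq> []" and fit: "fits p (last ls) (Tr k a k')"
    and a: "aregs a \<subseteq> {..<N}" and v: "asem a v v'" "\<forall>j<N. v' j < P"
  shows "carries p N (ls @ [Tr k a k']) P v'"
  unfolding carries_def
proof (intro allI impI)
  fix X b
  assume tr: "trace p N X" and m: "matches X b (ls @ [Tr k a k'])"
  let ?i = "b + int (length ls)"
  have m': "matches X b ls" and l: "letter X ?i = Tr k a k'"
    using m unfolding matches_append by (simp_all add: matches_Cons)
  have fit': "fits p (letter X (?i - 1)) (Tr k a k')"
    using fit matches_last[OF m' ls] by simp
  obtain \<phi> T where "stream (cur X (?i - 1)) P \<phi> v {..N} T"
    using c tr m' unfolding carries_def by blast
  from tr_stream[OF tr l fit' a this] v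
  obtain \<phi>' v'' T' where "asem a v v''" "stream (cur X ?i) P \<phi>' v'' {..N} T'" by blast
  moreover have "v'' = v'" using v(1) \<open>asem a v v''\<close> by (cases a) auto
  ultimately show "\<exists>\<phi> T. stream (cur X (b + int (length (ls @ [Tr k a k'])) - 1)) P \<phi> v' {..N} T"
    by auto
qed

text \<open>The steps that a clock of period P survives: only the N registers that own a track have
  to stay below it.\<close>

definition bounded_step :: "nat \<Rightarrow> nat \<Rightarrow> (conf \<times> conf) set" where
  "bounded_step N P = {((k, s), (k', s')) | k s k' s'. (\<exists>a. ctl k a k' \<and> asem a s s') \<and> (\<forall>j<N. s' j < P)}"

lemma run_bounded: "(c, d) \<in> run_step\<^sup>* \<Longrightarrow> \<exists>P0. \<forall>P\<ge>P0. (c, d) \<in> (bounded_step N P)\<^sup>*"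
proof (induction rule: rtrancl_induct)
  case (step d e)
  then obtain P0 where P0: "\<forall>P\<ge>P0. (c, d) \<in> (bounded_step N P)\<^sup>*" by blast
  obtain P1 where "\<forall>j<N. snd e j < P1"
    using finite_nat_set_iff_bounded[of "snd e ` {..<N}"] by auto
  then have "(d, e) \<in> bounded_step N P" if "P1 \<le> P" for P
    using that step.hyps(2) by (fastforce simp: run_step_def bounded_step_def)
  with P0 have "\<forall>P\<ge>max P0 P1. (c, e) \<in> (bounded_step N P)\<^sup>*"
    by (auto intro: rtrancl_into_rtrancl)
  then show ?case by blast
qed auto

section \<open>Finiteness of the alphabet\<close>

definition controls :: "prog \<Rightarrow> prog list set" where
  "controls p = insert [] (stacks p [])"

definition letters :: "prog \<Rightarrow> letter set" where
  "letters p = {Wall, Dbl, Ini, Fin, Dc, En} \<union> {Tr k a k' | k a k'. k \<in> controls p \<and> ctl k a k'}"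

lemma ctl_controls: "k \<in> controls p \<Longrightarrow> ctl k a k' \<Longrightarrow> k' \<in> controls p"
  unfolding controls_def using ctl_stacks[of k p "[]" a k'] by (auto elim: ctl.cases)

text \<open>The source control determines the action: that of an \<open>Act\<close> on top,
  otherwise \<open>Skip\<close>. This bounds the letters although the type \<open>act\<close> is
  infinite.\<close>

definition controls_acts :: "prog \<Rightarrow> act set" where
  "controls_acts p = insert Skip ((\<lambda>k. case k of Act a # _ \<Rightarrow> a | _ \<Rightarrow> Skip) ` controls p)"

lemma finite_controls_acts: "finite (controls_acts p)"
  by (simp add: controls_acts_def controls_def finite_stacks)

lemma ctl_acts: "k \<in> controls p \<Longrightarrow> ctl k a k' \<Longrightarrow> a \<in> controls_acts p"
  unfolding controls_acts_def by (auto elim!: ctl.cases simp: image_iff intro: bexI[of _ k])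

lemma finite_letters: "finite (letters p)"
proof -
  have "{Tr k a k' | k a k'. k \<in> controls p \<and> ctl k a k'} \<subseteq>
      (\<lambda>(k, a, k'). Tr k a k') ` (controls p \<times> controls_acts p \<times> controls p)"
    using ctl_controls ctl_acts by (fastforce simp: image_iff)
  moreover have "finite (controls p)" by (simp add: controls_def finite_stacks)
  ultimately have "finite {Tr k a k' | k a k'. k \<in> controls p \<and> ctl k a k'}"
    using finite_controls_acts by (meson finite_SigmaI finite_imageI finite_subset)
  then show ?thesis by (simp add: letters_def)
qed

text \<open>Positivity of N keeps track 1, which carries the flag of \<open>Dbl\<close> and register
  0.\<close>

lemma letters_registers: "\<exists>N>0. \<forall>k a k'. Tr k a k' \<in> letters p \<longrightarrow> aregs a \<subseteq> {..<N}"
proof -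
  have "finite (aregs a)" for a by (cases a) auto
  then have "finite (\<Union>a \<in> controls_acts p. aregs a)" using finite_controls_acts by blast
  then obtain N where N: "\<And>a. a \<in> controls_acts p \<Longrightarrow> aregs a \<subseteq> {..<N}"
    unfolding finite_nat_set_iff_bounded by blast
  have "aregs a \<subseteq> {..<Suc N}" if "Tr k a k' \<in> letters p" for k a k'
    using N[of a] ctl_acts[of k p a k'] that by (fastforce simp: letters_def)
  then show ?thesis by blast
qed

text \<open>Each step of the run appends its transition. The number \<open>m\<close> of doublings is
  fixed beforehand, since the period must exceed every value met on the way.\<close>

lemma run_word:
  assumes N: "0 < N" and regs: "\<forall>k a k'. Tr k a k' \<in> letters p \<longrightarrow> aregs a \<subseteq> {..<N}"
    and run: "(([p], \<lambda>_. 0), c) \<in> (bounded_step N (2 ^ m))\<^sup>*"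
  shows "\<exists>ls. ls \<noteq> [] \<and> hd ls = Wall \<and> set ls \<subseteq> letters p \<and> fst c \<in> controls p \<and>
    (last ls = Ini \<and> fst c = [p] \<or> (\<exists>k a. last ls = Tr k a (fst c))) \<and> carries p N ls (2 ^ m) (snd c)"
  using run
proof (induction rule: rtrancl_induct)
  case base
  have "[p] \<in> controls p" using start_in_stacks[of p "[]"] by (simp add: controls_def)
  then show ?case
    using carries_ini[OF N, of p m]
    by (intro exI[of _ "Wall # replicate m Dbl @ [Ini]"]) (auto simp: letters_def)
next
  case (step c d)
  then obtain ls where ls: "ls \<noteq> []" "hd ls = Wall" "set ls \<subseteq> letters p" "fst c \<in> controls p"
    "last ls = Ini \<and> fst c = [p] \<or> (\<exists>k a. last ls = Tr k a (fst c))"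
    "carries p N ls (2 ^ m) (snd c)"
    by blast
  from step.hyps(2) obtain a where a: "ctl (fst c) a (fst d)" "asem a (snd c) (snd d)"
    "\<forall>j<N. snd d j < 2 ^ m"
    by (auto simp: bounded_step_def)
  let ?l = "Tr (fst c) a (fst d)"
  have "?l \<in> letters p" using ls(4) a(1) by (auto simp: letters_def)
  moreover have "fits p (last ls) ?l" using ls(5) a(1) by auto
  ultimately have "carries p N (ls @ [?l]) (2 ^ m) (snd d)"
    using carries_snoc[OF ls(6,1)] regs a(2,3) by blast
  with ls \<open>?l \<in> letters p\<close> ctl_controls[OF ls(4) a(1)] show ?case
    by (intro exI[of _ "ls @ [?l]"]) auto
qed

text \<open>Phases are tracked exactly, 2 per cell, because a moment of silence on the whole
  countdown has to be found.\<close>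

lemma countdown_streams:
  assumes tr: "trace p N X" and N: "0 < N" and Fin: "letter X f = Fin"
    and Dc: "\<And>j. 0 < j \<Longrightarrow> j \<le> n \<Longrightarrow> letter X (f + int j) = Dc"
    and C: "stream (cur X f) P \<phi> v {0, 1} T" and v: "v 0 = n" and m: "m \<le> n"
  shows "stream (cur X (f + int m)) P (\<phi> + 2 * m) (v(0 := n - m)) {0, 1} (T + 2 * m)"
  using m
proof (induction m)
  case 0
  have "v(0 := n) = v" using v by auto
  then show ?case using C by simp
next
  case (Suc m)
  have eq: "f + int (Suc m) - 1 = f + int m" by simp
  have "letter X (f + int m) \<in> {Fin, Dc}"
    using Fin Dc[of m] Suc.prems by (cases "m = 0") auto
  moreover have "stream (cur X (f + int m)) P (\<phi> + 2 * m) (v(0 := n - m)) {0, 1} (T + 2 * m)"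
    by (rule Suc.IH) (use Suc.prems in simp)
  moreover have "n - m \<noteq> 0" "n - m - 1 = n - Suc m" using Suc.prems by simp_all
  ultimately show "stream (cur X (f + int (Suc m))) P (\<phi> + 2 * Suc m) (v(0 := n - Suc m)) {0, 1}
      (T + 2 * Suc m)"
    using dc_stream[OF tr N Dc[of "Suc m"], unfolded eq, of P "\<phi> + 2 * m" "v(0 := n - m)" "T + 2 * m"]
      Suc.prems by simp
qed

lemma test_word_complete:
  assumes N: "0 < N" and regs: "\<forall>k a k'. Tr k a k' \<in> letters p \<longrightarrow> aregs a \<subseteq> {..<N}"
    and run: "reaches p [] v" and n: "v 0 = n"
  shows "\<exists>ls. ls \<noteq> [] \<and> hd ls = Wall \<and> set ls \<subseteq> letters p \<and>
    (\<forall>X a. trace p N X \<longrightarrow> matches X a (ls @ map fst (test_word n)) \<longrightarrow>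
       (\<forall>T. \<exists>t\<ge>T. \<forall>j<n + 2. X t (a + int (length ls) + int j) = test_word n ! j))"
proof -
  obtain P0 where P0: "\<forall>P\<ge>P0. (([p], \<lambda>_. 0), ([], v)) \<in> (bounded_step N P)\<^sup>*"
    using run_bounded[OF run] by blast
  \<comment> \<open>As \<open>m < 2 ^ m\<close>, the period exceeds both the threshold of the run
    and, with some slack, the time one round of pulses takes to cross the test word.\<close>
  define m where "m = P0 + 2 * n + 5"
  define P :: nat where "P = 2 ^ m"
  have P: "P0 \<le> P" "2 * n + 5 < P"
    using less_exp[of m] unfolding P_def m_def by linarith+
  obtain ls where ls: "ls \<noteq> []" "hd ls = Wall" "set ls \<subseteq> letters p"
    "last ls = Ini \<and> [] = [p] \<or> (\<exists>k a. last ls = Tr k a [])" "carries p N ls P v"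
    using run_word[OF N regs P0[rule_format, OF P(1), unfolded P_def]] unfolding P_def by auto
  then obtain k0 a0 where last: "last ls = Tr k0 a0 []" by auto
  have "\<exists>t\<ge>T0. \<forall>j<n + 2. X t (a + int (length ls) + int j) = test_word n ! j"
    if tr: "trace p N X" and ma: "matches X a (ls @ map fst (test_word n))" for X a T0
  proof -
    define f where "f = a + int (length ls)"
    have m_ls: "matches X a ls" and m_test: "matches X f (map fst (test_word n))"
      using ma by (simp_all add: matches_append f_def)
    have lt: "letter X (f + int j) = fst (test_word n ! j)" if "j < n + 2" for j
      using m_test that by (simp add: matches_def length_test_word)
    have Fin: "letter X f = Fin" using lt[of 0] by (simp add: test_word_nth)
    have Dc: "letter X (f + int j) = Dc" if "0 < j" "j \<le> n" for j
      using lt[of j] test_word_nth(2)[of "j - 1" n] that by simp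
    have En: "letter X (f + int (Suc n)) = En"
      using lt[of "Suc n"] by (simp add: test_word_nth)
    have lf: "letter X (f - 1) = Tr k0 a0 []"
      using matches_last[OF m_ls ls(1)] last by (simp add: f_def)
    obtain \<phi>0 T1 where "stream (cur X (f - 1)) P \<phi>0 v {..N} T1"
      using ls(5) tr m_ls unfolding carries_def f_def by blast
    from fin_stream[OF tr N Fin lf this] obtain \<phi> T where
      C: "stream (cur X f) P \<phi> v {0, 1} T" by blast
    have S: "stream (cur X (f + int j)) P (\<phi> + 2 * j) (v(0 := n - j)) {0, 1} (T + 2 * j)"
      if "j \<le> n" for j
      by (rule countdown_streams[OF tr N Fin _ C n that]) (rule Dc)
    have eq: "f + int (Suc n) - 1 = f + int n" by simp
    have "letter X (f + int n) \<in> {Fin, Dc}"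
      using Fin Dc[of n] by (cases "n = 0") auto
    from en_stream[OF tr En, unfolded eq, OF this S[OF order_refl]]
    have E: "stream (cur X (f + int (Suc n))) P (\<phi> + 2 * n + 1) (v(0 := 0)) {0} (Suc (Suc (T + 2 * n)))"
      by simp
    \<comment> \<open>A pulse time of the last cell, moved by whole periods beyond \<open>T0\<close>
      and beyond the settling times of all cells.\<close>
    define t where "t = \<phi> + 2 * n + 1 + P * (T0 + T + 2 * n + 2)"
    have t_ge: "T0 + T + 2 * n + 2 \<le> t"
    proof -
      have "1 * (T0 + T + 2 * n + 2) \<le> P * (T0 + T + 2 * n + 2)"
        by (rule mult_le_mono1) (use P(2) in simp)
      then show ?thesis by (simp add: t_def)
    qed
    have t_cong: "[t + s = \<phi> + r] (mod P) \<longleftrightarrow> [2 * n + 1 + s = r] (mod P)" for s r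
    proof -
      have "t + s = \<phi> + (2 * n + 1 + s) + P * (T0 + T + 2 * n + 2)" by (simp add: t_def)
      then have "(t + s) mod P = (\<phi> + (2 * n + 1 + s)) mod P" by (simp only: mod_mult_self2)
      then have "[t + s = \<phi> + r] (mod P) \<longleftrightarrow> [\<phi> + (2 * n + 1 + s) = \<phi> + r] (mod P)"
        by (simp only: cong_def)
      then show ?thesis by (simp only: cong_add_lcancel_nat)
    qed
    \<comment> \<open>Cell \<open>j\<close> pulses at phases \<open>2 * j\<close> and
      \<open>n + j\<close>, at most \<open>2 * n\<close>, whereas t has phase
      \<open>2 * n + 1\<close>; the next round is still more than one step away.\<close>
    have quiet: "cur X (f + int j) (t + s) = {}" if "j \<le> n" "s \<le> 1" for j s
    proof -
      have "\<not> [t + s = \<phi> + 2 * j + offset (v(0 := n - j)) x] (mod P)" if "x \<in> {0, 1}" for x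
      proof -
        define r where "r = 2 * j + offset (v(0 := n - j)) x"
        have "r < 2 * n + 1 + s" "2 * n + 1 + s < P"
          using that \<open>j \<le> n\<close> \<open>s \<le> 1\<close> P(2) by (auto simp: r_def)
        then have "\<not> [2 * n + 1 + s = r] (mod P)" by (simp add: cong_def)
        then show ?thesis using t_cong[of s r] by (simp add: r_def add.assoc)
      qed
      moreover have "T + 2 * j \<le> t + s" using t_ge \<open>j \<le> n\<close> by simp
      ultimately show ?thesis using streamD[OF S[OF \<open>j \<le> n\<close>]] by blast
    qed
    have late: "Suc (Suc (T + 2 * n)) \<le> t" "Suc (Suc (T + 2 * n)) \<le> Suc t" using t_ge by simp_all
    have "x \<in> cur X (f + int (Suc n)) t \<longleftrightarrow> x = 0" for x
      using streamD[OF E late(1), of x] t_cong[of 0 "2 * n + 1"] by (cases x) (auto simp: add.assoc)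
    then have e0: "cur X (f + int (Suc n)) t = {0}" by blast
    have "\<not> [2 * n + 1 + 1 = 2 * n + 1] (mod P)" using P(2) by (simp add: cong_def)
    then have "x \<notin> cur X (f + int (Suc n)) (Suc t)" for x
      using streamD[OF E late(2), of x] t_cong[of 1 "2 * n + 1"] by (cases x) (auto simp: add.assoc)
    then have e1: "cur X (f + int (Suc n)) (Suc t) = {}" by blast
    have "X (Suc t) (f + int j) = test_word n ! j" if j: "j < n + 2" for j
    proof -
      consider "j = 0" | i where "j = Suc i" "i < n" | "j = Suc n"
        using j by (cases j) (auto simp: less_Suc_eq)
      then show ?thesis
      proof cases
        case 1
        then show ?thesis using trace_cell[OF tr, of t f] Fin quiet[of 0 0] quiet[of 0 1]
          by (simp add: test_word_nth)
      next
        case (2 i)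
        then show ?thesis
          using trace_cell[OF tr, of t "f + int j"] Dc[of j] quiet[of j 0] quiet[of j 1]
          by (simp add: test_word_nth)
      next
        case 3
        then show ?thesis using trace_cell[OF tr, of t "f + int j"] En e0 e1
          by (simp add: test_word_nth)
      qed
    qed
    moreover have "T0 \<le> Suc t" using t_ge by simp
    ultimately show ?thesis unfolding f_def by blast
  qed
  with ls(1-3) show ?thesis by blast
qed

text \<open>A wall ignores its left neighbour, so nothing from beyond it ever enters. This lets an
  occurrence time found for one configuration serve a whole cylinder.\<close>

lemma trace_agree:
  assumes "trace p N X" "trace p N Y" "\<And>i. a \<le> i \<Longrightarrow> i \<le> b \<Longrightarrow> X 0 i = Y 0 i" "letter X a = Wall"
  shows "a \<le> i \<Longrightarrow> i \<le> b \<Longrightarrow> X t i = Y t i"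
proof (induction t arbitrary: i)
  case 0
  then show ?case using assms(3) by simp
next
  case (Suc t)
  have step: "X (Suc t) i = cell_rule p N (X t (i - 1)) (X t i)"
    "Y (Suc t) i = cell_rule p N (Y t (i - 1)) (Y t i)"
    using assms(1,2) by (simp_all add: trace_def)
  show ?case
  proof (cases "i = a")
    case True
    have "fst (X t a) = Wall" using trace_letter[OF assms(1), of t a] assms(4) by simp
    then have "cell_rule p N z (X t a) = (Wall, {0}, fst (snd (X t a)))" for z
      by (cases z; cases "X t a") (simp add: cell_rule_def)
    then show ?thesis using step Suc.IH[OF Suc.prems] True by simp
  next
    case False
    then show ?thesis using step Suc.IH[of i] Suc.IH[of "i - 1"] Suc.prems by simp
  qed
qed

section \<open>Persistence\<close>

lemma space_bernoulli [simp]: "space (bernoulli q) = UNIV"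
  by (simp add: bernoulli_def space_PiM)

lemma prob_space_bernoulli: "prob_space (bernoulli q)"
  unfolding bernoulli_def by (rule prob_space_PiM) (rule measure_pmf.prob_space_axioms)

lemma bernoulli_coordinate: "(\<lambda>c. c i) \<in> bernoulli q \<rightarrow>\<^sub>M count_space UNIV"
proof -
  have "(\<lambda>c. c i) \<in> bernoulli q \<rightarrow>\<^sub>M measure_pmf (pmf_of_set {..<q})"
    unfolding bernoulli_def by (rule measurable_component_singleton) simp
  then show ?thesis by (simp cong: measurable_cong_sets)
qed

lemma bernoulli_window:
  "(\<lambda>c. map (\<lambda>j. c (f j)) js) \<in> bernoulli q \<rightarrow>\<^sub>M count_space UNIV"
proof (induction js)
  case (Cons j js)
  have "(\<lambda>c. c (f j) # map (\<lambda>j. c (f j)) js) \<in> bernoulli q \<rightarrow>\<^sub>M count_space UNIV"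
    by (rule measurable_compose_countable[OF measurable_compose_countable[OF _ Cons.IH]
          bernoulli_coordinate[of "f j"]]) simp
  then show ?case by simp
qed simp

lemma measurable_CA_global: "CA_global r \<delta> \<in> bernoulli q \<rightarrow>\<^sub>M bernoulli q"
proof -
  have "(\<lambda>c. CA_global r \<delta> c i) \<in> bernoulli q \<rightarrow>\<^sub>M measure_pmf (pmf_of_set {..<q})" for i
  proof -
    have "(\<lambda>c. CA_global r \<delta> c i) \<in> bernoulli q \<rightarrow>\<^sub>M count_space UNIV"
      unfolding CA_global_def by (rule measurable_compose[OF bernoulli_window]) simp
    then show ?thesis by (simp cong: measurable_cong_sets)
  qed
  then have "CA_global r \<delta> \<in> bernoulli q \<rightarrow>\<^sub>M PiM UNIV (\<lambda>_. measure_pmf (pmf_of_set {..<q}))"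
    by (intro measurable_PiM_single') (simp_all add: PiE_def)
  then show ?thesis unfolding bernoulli_def .
qed

lemma sets_bernoulli_Collect:
  assumes "finite J"
  shows "{c. \<forall>i\<in>J. c i \<in> A i} \<in> sets (bernoulli q)"
proof -
  have "{c \<in> space (bernoulli q). \<forall>i\<in>J. c i \<in> A i} \<in> sets (bernoulli q)"
  proof (intro sets.sets_Collect_finite_All assms)
    show "{c \<in> space (bernoulli q). c i \<in> A i} \<in> sets (bernoulli q)" for i
      using measurable_sets[OF bernoulli_coordinate[of i q], of "A i"] by (simp add: vimage_def)
  qed
  then show ?thesis by simp
qed

lemma measure_bernoulli_Collect:
  assumes "finite J"
  shows "measure (bernoulli q) {c. \<forall>i\<in>J. c i \<in> A i} =
    (\<Prod>i\<in>J. measure (measure_pmf (pmf_of_set {..<q})) (A i))"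
proof -
  let ?M = "\<lambda>_ :: int. measure_pmf (pmf_of_set {..<q})"
  interpret product_prob_space ?M "UNIV :: int set"
    by (rule product_prob_spaceI) (rule measure_pmf.prob_space_axioms)
  have eq: "prod_emb UNIV ?M J (PiE J A) = {c. \<forall>i\<in>J. c i \<in> A i}"
    by (auto simp: prod_emb_def PiE_iff)
  show ?thesis
    using measure_PiM_emb[of J A] assms unfolding eq bernoulli_def by simp
qed

lemma cylinder_alt:
  "cylinder u a = {c. \<forall>i\<in>{a..<a + int (length u)}. c i \<in> {u ! nat (i - a)}}"
proof -
  have "(\<forall>j<length u. c (a + int j) = u ! j) \<longleftrightarrow>
      (\<forall>i\<in>{a..<a + int (length u)}. c i \<in> {u ! nat (i - a)})" (is "?l \<longleftrightarrow> ?r") for c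
  proof
    assume l: ?l
    show ?r
    proof
      fix i assume "i \<in> {a..<a + int (length u)}"
      then show "c i \<in> {u ! nat (i - a)}" using l[rule_format, of "nat (i - a)"] by auto
    qed
  next
    assume r: ?r
    show ?l
    proof (intro allI impI)
      fix j assume "j < length u"
      then show "c (a + int j) = u ! j" using r[rule_format, of "a + int j"] by simp
    qed
  qed
  then show ?thesis unfolding cylinder_def by blast
qed

lemma sets_cylinder: "cylinder u a \<in> sets (bernoulli q)"
  unfolding cylinder_alt by (rule sets_bernoulli_Collect) simp

lemma measure_cylinder_pos:
  assumes "set u \<subseteq> {..<q}"
  shows "0 < measure (bernoulli q) (cylinder u a)"
proof -
  have "0 < measure (measure_pmf (pmf_of_set {..<q})) {s}" if "s < q" for s
    using that by (simp add: measure_pmf_single lessThan_empty_iff)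
  moreover have "u ! nat (i - a) < q" if "i \<in> {a..<a + int (length u)}" for i
  proof -
    have "u ! nat (i - a) \<in> set u" using that by (intro nth_mem) auto
    then show ?thesis using assms by auto
  qed
  ultimately show ?thesis
    unfolding cylinder_alt by (subst measure_bernoulli_Collect) (auto intro!: prod_pos)
qed

text \<open>The n cells left of the origin all avoid \<open>s\<close> with probability
  \<open>x ^ n\<close>, where x < 1 is the weight of the other symbols.\<close>

lemma AE_bernoulli_symbol_left:
  assumes "s < q"
  shows "AE c in bernoulli q. \<exists>w<0. c w = s"
proof -
  interpret prob_space "bernoulli q" by (rule prob_space_bernoulli)
  define B where "B n = {c :: int \<Rightarrow> nat. \<forall>i\<in>{- int n..<0}. c i \<in> - {s}}" for n
  define x where "x = measure (measure_pmf (pmf_of_set {..<q})) (- {s})"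
  have sets: "B n \<in> sets (bernoulli q)" for n
    unfolding B_def by (rule sets_bernoulli_Collect) simp
  have B: "prob (B n) = x ^ n" for n
    unfolding B_def x_def by (subst measure_bernoulli_Collect) simp_all
  have "x = 1 - measure (measure_pmf (pmf_of_set {..<q})) {s}"
    unfolding x_def using measure_pmf.prob_compl[of "{s}" "pmf_of_set {..<q}"] by (simp add: Compl_eq_Diff_UNIV)
  moreover have "0 < measure (measure_pmf (pmf_of_set {..<q})) {s}"
    using assms by (simp add: measure_pmf_single lessThan_empty_iff)
  ultimately have "x < 1" by simp
  moreover have "0 \<le> x" by (simp add: x_def)
  ultimately have "(\<lambda>n. x ^ n) \<longlonglongrightarrow> 0" by (simp add: LIMSEQ_realpow_zero)
  moreover have "prob (\<Inter>n. B n) \<le> x ^ n" for n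
    unfolding B[symmetric] using sets by (intro finite_measure_mono) auto
  ultimately have "prob (\<Inter>n. B n) \<le> 0" by (intro LIMSEQ_le_const) auto
  then have "prob (\<Inter>n. B n) = 0" using measure_nonneg[of "bernoulli q" "\<Inter>n. B n"] by linarith
  then have "emeasure (bernoulli q) (\<Inter>n. B n) = 0" by (simp add: emeasure_eq_measure)
  moreover have "{c \<in> space (bernoulli q). \<not> (\<exists>w<0. c w = s)} \<subseteq> (\<Inter>n. B n)"
    by (auto simp: B_def)
  moreover have "(\<Inter>n. B n) \<in> sets (bernoulli q)" using sets by blast
  ultimately show ?thesis by (intro AE_I)
qed

section \<open>Criteria for persistence\<close>

lemma (in finite_measure) measure_tendsto_0:
  assumes E: "\<And>n :: nat. E n \<in> sets M" and ev: "AE x in M. eventually (\<lambda>n. x \<notin> E n) sequentially"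
  shows "(\<lambda>n. measure M (E n)) \<longlonglongrightarrow> 0"
proof -
  have "(\<lambda>n. integral\<^sup>L M (indicator (E n) :: _ \<Rightarrow> real)) \<longlonglongrightarrow> integral\<^sup>L M (\<lambda>_. 0 :: real)"
  proof (rule integral_dominated_convergence[where w = "\<lambda>_. 1"])
    show "AE x in M. (\<lambda>n. indicator (E n) x :: real) \<longlonglongrightarrow> 0"
      using ev
    proof eventually_elim
      case (elim x)
      then have "eventually (\<lambda>n. indicator (E n) x = (0 :: real)) sequentially"
        by eventually_elim simp
      then show ?case by (rule tendsto_eventually)
    qed
  qed (use E in \<open>auto simp: indicator_def\<close>)
  moreover have "integral\<^sup>L M (indicator (E n) :: _ \<Rightarrow> real) = measure M (E n)" for n
    using E[of n] sets.sets_into_space[OF E[of n]] by (simp add: Int_absorb1 Int_absorb2)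
  ultimately show ?thesis by simp
qed

lemma sets_CA_preimage:
  "(CA_global r \<delta> ^^ n) -` cylinder u a \<in> sets (bernoulli q)"
proof -
  have "(CA_global r \<delta> ^^ n) \<in> bernoulli q \<rightarrow>\<^sub>M bernoulli q"
  proof (induction n)
    case (Suc n)
    show ?case unfolding funpow.simps by (rule measurable_comp[OF Suc measurable_CA_global])
  qed (simp add: id_def)
  from measurable_sets[OF this sets_cylinder, of u a] show ?thesis by simp
qed

lemma not_persistentI:
  assumes "AE c in bernoulli q. eventually (\<lambda>t. (CA_global r \<delta> ^^ t) c \<notin> cylinder u 0) sequentially"
  shows "\<not> persistent q r \<delta> u"
proof -
  interpret prob_space "bernoulli q" by (rule prob_space_bernoulli)
  show ?thesis
    unfolding persistent_def
    using measure_tendsto_0[where E = "\<lambda>t. (CA_global r \<delta> ^^ t) -` cylinder u 0", OF sets_CA_preimage]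
      assms by simp
qed

text \<open>A cylinder of positive measure that lies in infinitely many of the preimages keeps their
  measures from tending to 0.\<close>

lemma persistentI:
  assumes w: "set w \<subseteq> {..<q}"
    and inf: "\<And>T. \<exists>t\<ge>T. cylinder w a \<subseteq> (CA_global r \<delta> ^^ t) -` cylinder u 0"
  shows "persistent q r \<delta> u"
proof -
  interpret prob_space "bernoulli q" by (rule prob_space_bernoulli)
  let ?\<mu> = "\<lambda>t. prob ((CA_global r \<delta> ^^ t) -` cylinder u 0)"
  have False if "?\<mu> \<longlonglongrightarrow> 0"
  proof -
    have "eventually (\<lambda>t. ?\<mu> t < prob (cylinder w a)) sequentially"
      using that measure_cylinder_pos[OF w] by (rule order_tendstoD)
    then obtain T where T: "\<And>t. T \<le> t \<Longrightarrow> ?\<mu> t < prob (cylinder w a)"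
      unfolding eventually_sequentially by blast
    obtain t where "T \<le> t" "cylinder w a \<subseteq> (CA_global r \<delta> ^^ t) -` cylinder u 0"
      using inf by blast
    then have "prob (cylinder w a) \<le> ?\<mu> t" by (intro finite_measure_mono sets_CA_preimage)
    with T[OF \<open>T \<le> t\<close>] show False by simp
  qed
  then show ?thesis unfolding persistent_def by auto
qed

section \<open>Numbering the cells, and the reduction\<close>

definition cells :: "prog \<Rightarrow> nat \<Rightarrow> cell set" where
  "cells p N = letters p \<times> Pow {..N} \<times> Pow {..N}"

lemma finite_cells: "finite (cells p N)"
  by (simp add: cells_def finite_letters)

lemma cells_nonempty: "cells p N \<noteq> {}"
  by (auto simp: cells_def letters_def)

lemma cell_rule_cells: "x \<in> cells p N \<Longrightarrow> y \<in> cells p N \<Longrightarrow> cell_rule p N x y \<in> cells p N"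
  by (auto simp: cells_def cell_rule_def split: if_splits)

text \<open>In a window of radius 1, entry 0 is the left neighbour and entry 1 the cell itself; the
  right neighbour is ignored, so information flows one way.\<close>

definition local_rule :: "prog \<Rightarrow> nat \<Rightarrow> nat list \<Rightarrow> nat" where
  "local_rule p N w = to_nat_on (cells p N)
     (cell_rule p N (from_nat_into (cells p N) (w ! 0)) (from_nat_into (cells p N) (w ! 1)))"

lemma from_nat_into_cells: "from_nat_into (cells p N) s \<in> cells p N"
  by (rule from_nat_into) (rule cells_nonempty)

lemma to_nat_on_cells: "x \<in> cells p N \<Longrightarrow> to_nat_on (cells p N) x < card (cells p N)"
  using bij_betwE[OF to_nat_on_finite[OF finite_cells]] by blast

lemma decode_encode [simp]:
  "x \<in> cells p N \<Longrightarrow> from_nat_into (cells p N) (to_nat_on (cells p N) x) = x"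
  by (intro from_nat_into_to_nat_on countable_finite finite_cells)

lemma local_rule_bound: "local_rule p N w < card (cells p N)"
  unfolding local_rule_def by (intro to_nat_on_cells cell_rule_cells from_nat_into_cells)

lemma is_CA_local_rule: "is_CA (card (cells p N)) (Suc 0) (local_rule p N)"
  using local_rule_bound finite_cells cells_nonempty
  by (auto simp: is_CA_def Suc_le_eq card_gt_0_iff)

text \<open>Numbers outside the alphabet also decode to some cell, so every configuration yields a
  trace.\<close>

definition decoded :: "prog \<Rightarrow> nat \<Rightarrow> (int \<Rightarrow> nat) \<Rightarrow> nat \<Rightarrow> int \<Rightarrow> cell" where
  "decoded p N c t i = from_nat_into (cells p N) ((CA_global (Suc 0) (local_rule p N) ^^ t) c i)"

lemma CA_global_local_rule:
  "CA_global (Suc 0) (local_rule p N) c i = to_nat_on (cells p N)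
     (cell_rule p N (from_nat_into (cells p N) (c (i - 1))) (from_nat_into (cells p N) (c i)))"
  by (simp add: CA_global_def local_rule_def upt_rec numeral_eq_Suc)

lemma trace_decoded: "trace p N (decoded p N c)"
  unfolding trace_def decoded_def
  by (auto simp: CA_global_local_rule cell_rule_cells from_nat_into_cells)

text \<open>Stated for positive times: after one step all symbols lie in the alphabet, where
  decoding is injective.\<close>

lemma decoded_cylinder:
  assumes "set u \<subseteq> {..<card (cells p N)}"
  shows "(CA_global (Suc 0) (local_rule p N) ^^ Suc t) c \<in> cylinder u 0 \<longleftrightarrow>
    (\<forall>j<length u. decoded p N c (Suc t) (int j) = from_nat_into (cells p N) (u ! j))"
proof -
  have "(CA_global (Suc 0) (local_rule p N) ^^ Suc t) c (int j) = u ! j \<longleftrightarrow>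
      decoded p N c (Suc t) (int j) = from_nat_into (cells p N) (u ! j)" if "j < length u" for j
  proof -
    have "u ! j < card (cells p N)" using assms nth_mem[OF that] by auto
    moreover have "(CA_global (Suc 0) (local_rule p N) ^^ Suc t) c (int j) < card (cells p N)"
      by (simp add: CA_global_local_rule to_nat_on_cells cell_rule_cells from_nat_into_cells)
    ultimately show ?thesis
      unfolding decoded_def
      using bij_betw_from_nat_into_finite[OF finite_cells, of p N]
      by (auto simp: bij_betw_def inj_on_eq_iff)
  qed
  then show ?thesis by (simp add: cylinder_def)
qed

lemma test_word_cells: "set (test_word n) \<subseteq> cells p N"
  by (auto simp: test_word_def cells_def letters_def)

lemma persistent_test_word_iff:
  assumes N: "0 < N" and regs: "\<forall>k a k'. Tr k a k' \<in> letters p \<longrightarrow> aregs a \<subseteq> {..<N}"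
  shows "persistent (card (cells p N)) (Suc 0) (local_rule p N) (map (to_nat_on (cells p N)) (test_word n))
    \<longleftrightarrow> (\<exists>v. reaches p [] v \<and> v 0 = n)"
proof -
  define u where "u = map (to_nat_on (cells p N)) (test_word n)"
  define q where "q = card (cells p N)"
  have u: "set u \<subseteq> {..<card (cells p N)}"
    unfolding u_def set_map using to_nat_on_cells test_word_cells[of n p N] by blast
  have u_nth: "from_nat_into (cells p N) (u ! j) = test_word n ! j" if "j < n + 2" for j
  proof -
    have j: "j < length (test_word n)" using that by (simp add: length_test_word)
    then have "test_word n ! j \<in> cells p N" using test_word_cells nth_mem by blast
    with j show ?thesis by (simp add: u_def)
  qed
  have len: "length u = n + 2" by (simp add: u_def length_test_word)
  have occ: "(CA_global (Suc 0) (local_rule p N) ^^ Suc t) c \<in> cylinder u 0 \<longleftrightarrow>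
      (\<forall>j<n + 2. decoded p N c (Suc t) (int j) = test_word n ! j)" for c t
    unfolding decoded_cylinder[OF u] len using u_nth by metis
  have letter_in: "letter (decoded p N c) i \<in> letters p" for c i
    using from_nat_into_cells[of p N "c i"] by (auto simp: letter_def decoded_def cells_def)
  have "persistent q (Suc 0) (local_rule p N) u" if run: "reaches p [] v" "v 0 = n" for v
  proof -
    obtain ls where ls: "ls \<noteq> []" "hd ls = Wall" "set ls \<subseteq> letters p" and
      occurs: "\<And>X a T. trace p N X \<Longrightarrow> matches X a (ls @ map fst (test_word n)) \<Longrightarrow>
        \<exists>t\<ge>T. \<forall>j<n + 2. X t (a + int (length ls) + int j) = test_word n ! j"
      using test_word_complete[OF N regs run] by blast
    define ms where "ms = ls @ map fst (test_word n)"
    \<comment> \<open>Full cell states are prescribed, not just letters, so that all configurations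
      of the cylinder share phases and occurrence times.\<close>
    define w where "w = map (\<lambda>l. to_nat_on (cells p N) (l, {}, {})) ms"
    \<comment> \<open>This places the test word at the origin.\<close>
    define a where "a = - int (length ls)"
    have ms: "(l, {}, {}) \<in> cells p N" if "l \<in> set ms" for l
      using that ls(3) test_word_cells[of n p N] by (auto simp: ms_def cells_def)
    have w: "set w \<subseteq> {..<q}"
      unfolding w_def q_def set_map using to_nat_on_cells ms by blast
    have len_ms: "length ms = length ls + (n + 2)" by (simp add: ms_def length_test_word)
    have init: "decoded p N c 0 (a + int j) = (ms ! j, {}, {})"
      if "c \<in> cylinder w a" "j < length ms" for c j
      using that ms[OF nth_mem[OF that(2)]] by (simp add: cylinder_def decoded_def w_def)
    have match: "matches (decoded p N c) a ms" if "c \<in> cylinder w a" for c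
      using init[OF that] by (simp add: matches_def letter_def)
    have "\<exists>t\<ge>T. cylinder w a \<subseteq> (CA_global (Suc 0) (local_rule p N) ^^ t) -` cylinder u 0" for T
    proof -
      obtain c0 where c0: "c0 \<in> cylinder w a"
      proof -
        have "cylinder w a \<noteq> {}" using measure_cylinder_pos[OF w, of a] by auto
        then show ?thesis using that by blast
      qed
      obtain t where t: "Suc T \<le> t"
        "\<forall>j<n + 2. decoded p N c0 t (a + int (length ls) + int j) = test_word n ! j"
        using occurs[OF trace_decoded match[OF c0, unfolded ms_def]] by blast
      then obtain t' where t': "t = Suc t'" by (cases t) auto
      have "(CA_global (Suc 0) (local_rule p N) ^^ t) c \<in> cylinder u 0" if c: "c \<in> cylinder w a" for c
        unfolding t' occ
      proof (intro allI impI)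
        fix j assume j: "j < n + 2"
        have agree: "decoded p N c0 0 i = decoded p N c 0 i" if "a \<le> i" "i \<le> int (n + 1)" for i
        proof -
          have "nat (i - a) < length ms" "i = a + int (nat (i - a))"
            using that by (auto simp: len_ms a_def)
          then show ?thesis using init[OF c0, of "nat (i - a)"] init[OF c, of "nat (i - a)"] by simp
        qed
        have wall: "letter (decoded p N c0) a = Wall"
          using match[OF c0, unfolded matches_def, rule_format, of 0] ls(1,2) len_ms
          by (simp add: ms_def hd_conv_nth nth_append)
        have "a \<le> int j" by (simp add: a_def)
        moreover have "int j \<le> int (n + 1)" unfolding of_nat_le_iff using j by simp
        ultimately have "decoded p N c0 t (int j) = decoded p N c t (int j)"
          using trace_agree[OF trace_decoded trace_decoded agree wall] by blast
        then show "decoded p N c (Suc t') (int j) = test_word n ! j"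
          using t(2) j by (simp add: a_def t')
      qed
      then have "cylinder w a \<subseteq> (CA_global (Suc 0) (local_rule p N) ^^ t) -` cylinder u 0" by blast
      moreover have "T \<le> t" using t(1) by simp
      ultimately show ?thesis by blast
    qed
    then show ?thesis by (rule persistentI[OF w])
  qed
  moreover have "\<not> persistent q (Suc 0) (local_rule p N) u" if no: "\<nexists>v. reaches p [] v \<and> v 0 = n"
  proof (rule not_persistentI)
    let ?wall = "(Wall, {}, {}) :: cell"
    have wall: "?wall \<in> cells p N" by (simp add: cells_def letters_def)
    have "AE c in bernoulli q. \<exists>w<0. c w = to_nat_on (cells p N) ?wall"
      using to_nat_on_cells[OF wall] unfolding q_def by (rule AE_bernoulli_symbol_left)
    then show "AE c in bernoulli q. eventually (\<lambda>t. (CA_global (Suc 0) (local_rule p N) ^^ t) c \<notin> cylinder u 0)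
        sequentially"
    proof eventually_elim
      case (elim c)
      then obtain w where "w < 0" "c w = to_nat_on (cells p N) ?wall" by blast
      then have w: "w \<le> 0" "letter (decoded p N c) w = Wall"
        using wall by (simp_all add: letter_def decoded_def)
      have regs': "aregs a \<subseteq> {..<N}" if "letter (decoded p N c) i = Tr k a k'" for i k a k'
        using regs letter_in[of c i] that by metis
      have "\<not> (\<forall>T. \<exists>t\<ge>T. \<forall>j<n + 2. decoded p N c t (int j) = test_word n ! j)"
        using test_word_sound[OF trace_decoded N _ w] regs' no by blast
      then obtain T where T: "\<And>t. T \<le> t \<Longrightarrow> \<not> (\<forall>j<n + 2. decoded p N c t (int j) = test_word n ! j)"
        by blast
      have "(CA_global (Suc 0) (local_rule p N) ^^ t) c \<notin> cylinder u 0" if t: "Suc T \<le> t" for t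
      proof -
        obtain t' where "t = Suc t'" using t by (cases t) auto
        then show ?thesis using T[of t] t occ[of t' c] by simp
      qed
      then show ?case unfolding eventually_sequentially by blast
    qed
  qed
  ultimately show ?thesis unfolding u_def q_def by blast
qed

theorem mainTheorem6:
  shows "\<exists>q r \<delta>. is_CA q r \<delta> \<and> \<not> recursive_lang (persistent_lang q r \<delta>)"
proof -
  obtain N where N: "0 < N" "\<forall>k a k'. Tr k a k' \<in> letters acceptor \<longrightarrow> aregs a \<subseteq> {..<N}"
    using letters_registers by blast
  let ?C = "cells acceptor N"
  let ?code = "to_nat_on ?C"
  let ?L = "persistent_lang (card ?C) (Suc 0) (local_rule acceptor N)"
  have "map ?code (test_word n) \<in> ?L \<longleftrightarrow> n \<in> self_accepting" for n
  proof -
    have "map ?code (test_word n) \<in> lists {..<card ?C}"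
      using test_word_cells[of n acceptor N] to_nat_on_cells by (auto simp: in_lists_conv_set)
    then have "map ?code (test_word n) \<in> ?L \<longleftrightarrow> (\<exists>v. reaches acceptor [] v \<and> v 0 = n)"
      using persistent_test_word_iff[OF N] by (simp add: persistent_lang_def)
    then show ?thesis using psem_acceptor by (simp add: run_iff_psem)
  qed
  \<comment> \<open>The coded test words form a pumped family over three fixed symbols, so a decider
    for the language would decide the diagonal set.\<close>
  then have "{n. ?code (Fin, {}, {}) # replicate n (?code (Dc, {}, {})) @ [?code (En, {}, {0})] \<in> ?L}
      = self_accepting"
    by (auto simp: test_word_def)
  then have "\<not> recursive_lang ?L"
    using recursive_lang_pumped[of ?L "?code (Fin, {}, {})" "?code (Dc, {}, {})" "?code (En, {}, {0})"]
      not_recursive_self_accepting by auto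
  then show ?thesis using is_CA_local_rule by blast
qed

end
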